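(* Let $p>3$ be a prime and consider the exterior algebra $E[h_{2,j},h_{3,j},h_{4,j},h_{5,j}\mid j\in\mathbb{Z}/4]$ over $\mathbb{Z}/p$ with the differential $d$ (a graded derivation, all $h$'s of degree 1) determined by $d(h_{2,j})=d(h_{3,j})=0$, $d(h_{4,j})=-h_{2,j}h_{2,j+2}$, $d(h_{5,j})=-(h_{2,j}h_{3,j+2}+h_{3,j}h_{2,j+3})$ (indices mod 4). Its cohomology has Poincaré series $$(1+t)^4(1+6t+18t^2+59t^3+92t^4+176t^5+161t^6+176t^7+92t^8+59t^9+18t^{10}+6t^{11}+t^{12}).$$ In particular, the ranks in cohomological dimensions $0,1,2,\dots,9$ are $1,10,48,171,461,976,1671,2303,2558,2303$, and the rank in dimension $16$ is $1$.
   Context: This differential graded algebra is the reduced first May $E_1$-term, with its first May differential, of the May spectral sequence for the Hopf algebra $S(4,2)=\mathbb{Z}/p[t_2,t_3,\dots]/(t_s^{p^4}-t_s)$ at primes $p\geq 5$; its cohomology is the May $E_2$-term for $\mathrm{Ext}_{S(4,2)}(\mathbb{Z}/p,\mathbb{Z}/p)$. Only the algebraic description above is needed. *)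

theory Defs
  imports Main "HOL-Library.Function_Algebras" "HOL-Computational_Algebra.Polynomial"
begin

text \<open>Exterior algebra E[h_{i,j} | i in {2,3,4,5}, j in Z/4] over a field 'a.
  Generator h_{i,j} is encoded by the natural number 4*(i-2) + (j mod 4), so the
  generators are 0..15, ordered.  An element is given by its coefficient function
  on the basis of ordered monomials e_S = h_{s1} h_{s2} ... h_{sk} (s1 < ... < sk),
  S a subset of the generators.\<close>

type_synonym 'a ext = "nat set \<Rightarrow> 'a"

definition gens :: "nat set" where "gens = {..<16}"

definition gen :: "nat \<Rightarrow> nat \<Rightarrow> nat" where
  "gen i j = 4 * (i - 2) + j mod 4"

definition inv_count :: "nat set \<Rightarrow> nat set \<Rightarrow> nat" where
  "inv_count A B = card {(a, b). a \<in> A \<and> b \<in> B \<and> b < a}"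

definition emon :: "nat set \<Rightarrow> 'a::comm_ring_1 ext" where
  "emon S = (\<lambda>T. if T = S then 1 else 0)"

definition ezero :: "'a::comm_ring_1 ext" where "ezero = (\<lambda>_. 0)"
definition eadd :: "'a::comm_ring_1 ext \<Rightarrow> 'a ext \<Rightarrow> 'a ext" where
  "eadd x y = (\<lambda>S. x S + y S)"
definition eneg :: "'a::comm_ring_1 ext \<Rightarrow> 'a ext" where
  "eneg x = (\<lambda>S. - x S)"
definition escale :: "'a::comm_ring_1 \<Rightarrow> 'a ext \<Rightarrow> 'a ext" where
  "escale c x = (\<lambda>S. c * x S)"

text \<open>exterior product: e_A e_B = 0 if A, B meet, else (-1)^(inversions) e_(A \<union> B)\<close>
definition emult :: "'a::comm_ring_1 ext \<Rightarrow> 'a ext \<Rightarrow> 'a ext" where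
  "emult x y = (\<lambda>S. if S \<subseteq> gens then
      (\<Sum>A\<in>Pow S. (-1) ^ inv_count A (S - A) * x A * y (S - A)) else 0)"

definition hgen :: "nat \<Rightarrow> nat \<Rightarrow> 'a::comm_ring_1 ext" where
  "hgen i j = emon {gen i j}"

definition dh :: "nat \<Rightarrow> nat \<Rightarrow> 'a::comm_ring_1 ext" where
  "dh i j = (if i = 4 then eneg (emult (hgen 2 j) (hgen 2 (j + 2)))
             else if i = 5 then eneg (eadd (emult (hgen 2 j) (hgen 3 (j + 2)))
                                           (emult (hgen 3 j) (hgen 2 (j + 3))))
             else ezero)"

definition dgen :: "nat \<Rightarrow> 'a::comm_ring_1 ext" where
  "dgen k = dh (k div 4 + 2) (k mod 4)"

text \<open>graded derivation on a basis monomial e_S = e_{<k} h_k e_{>k}: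
  d(e_S) = sum over k in S of (-1)^{#(a in S, a<k)} e_{<k} d(h_k) e_{>k}\<close>
definition ediff_basis :: "nat set \<Rightarrow> 'a::comm_ring_1 ext" where
  "ediff_basis S = (\<lambda>T. \<Sum>k\<in>S. (-1) ^ card {a\<in>S. a < k} *
      emult (emult (emon {a\<in>S. a < k}) (dgen k)) (emon {a\<in>S. k < a}) T)"

definition ediff :: "'a::comm_ring_1 ext \<Rightarrow> 'a ext" where
  "ediff x = (\<lambda>T. \<Sum>S\<in>Pow gens. x S * ediff_basis S T)"

definition cochains :: "nat \<Rightarrow> 'a::comm_ring_1 ext set" where
  "cochains n = {x. \<forall>S. x S \<noteq> 0 \<longrightarrow> S \<subseteq> gens \<and> card S = n}"

definition cocycles :: "nat \<Rightarrow> 'a::comm_ring_1 ext set" where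
  "cocycles n = {x \<in> cochains n. ediff x = ezero}"

definition coboundaries :: "nat \<Rightarrow> 'a::comm_ring_1 ext set" where
  "coboundaries n = {ediff x | x m. x \<in> cochains m \<and> Suc m = n}"

definition cohom_rank :: "'a::field itself \<Rightarrow> nat \<Rightarrow> nat" where
  "cohom_rank _ n = vector_space.dim (escale :: 'a \<Rightarrow> 'a ext \<Rightarrow> 'a ext) (cocycles n)
                  - vector_space.dim (escale :: 'a \<Rightarrow> 'a ext \<Rightarrow> 'a ext) (coboundaries n)"

definition poincare_poly :: "int poly" where
  "poincare_poly = [:1, 1:] ^ 4 *
     Poly [1, 6, 18, 59, 92, 176, 161, 176, 92, 59, 18, 6, 1]"

end

theory Submission
  imports Defs "HOL-Library.FuncSet" "HOL-Library.Nat_Bijection"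
begin

text \<open>
  Let \<open>lmul k\<close> and \<open>contr k\<close> denote left multiplication by and contraction with the generator
  \<open>h_k\<close>. They satisfy the canonical anticommutation relations, and the differential is the sum of
  the operators \<open>dgen k \<cdot> contr k\<close>. Since \<open>h_{4,j} + h_{4,j+2}\<close> is a cocycle, a unipotent change of
  variables removes the generators 10 and 11 from the differential, so that they split off as an
  exterior algebra; this gives a factor \<open>(1 + t)^2\<close> and leaves a complex on 14 generators.
  The ranks of its differentials are computed by sparse Gaussian elimination over the integers, in
  which only divisors of \<open>6 ^ 8\<close> occur as pivots; hence the result holds in every
  characteristic larger than 3. Over a finite field with \<open>q\<close> elements a subspace of dimension \<open>d\<close> has
  \<open>q ^ d\<close> elements, which reduces rank-nullity and the splitting to counting.
\<close>

section \<open>Left multiplication and contraction\<close>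

text \<open>The generators \<open>h_{4,j}\<close> and \<open>h_{4,j+2}\<close> have opposite
  differentials because \<open>h_{2,j}\<close> and \<open>h_{2,j+2}\<close> anticommute; this is the
  source of the split factor. It cuts the middle degree from 12870 to 3432 monomials. The other
  factor \<open>(1 + t)^2\<close> of the stated series is not derived structurally; it comes out of
  the computed ranks. As \<open>p\<close> is arbitrary, the elimination must not divide. A row
  \<open>q\<close> with leading coefficient \<open>f\<close> is replaced by
  \<open>p q - f r\<close>, where \<open>r\<close> is the stored row with pivot \<open>p\<close>;
  over a field this keeps the row span whenever \<open>p\<close> is nonzero there. So one integer
  run is valid in every characteristic that divides no pivot. The run is proved sound only: it may
  return \<open>None\<close>, and its success is shown by evaluation. If \<open>r_n\<close> is the
  rank of the differential from degree \<open>n\<close> to \<open>n + 1\<close>, the cohomology has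
  rank \<open>(16 choose n) - r_n - r_(n-1)\<close>, so only these numbers are needed.\<close>

lemma additive_sum:
  assumes "h 0 = 0" "\<And>x y. h (x + y) = h x + h y"
  shows "h (\<Sum>i\<in>I. f i) = (\<Sum>i\<in>I. h (f i))"
  using sum_comp_morphism[of h f I] assms by (simp add: o_def)

lemma sum_fun_apply: "(\<Sum>i\<in>I. f i) T = (\<Sum>i\<in>I. f i T)"
  by (rule additive_sum[of "\<lambda>x. x T"]) simp_all

lemma ext_ops: "eadd x y = x + y" "ezero = 0" "eneg x = - x"
  by (auto simp: eadd_def ezero_def eneg_def)

text \<open>Koszul sign: a factor \<open>h_k\<close> moved from the front to its place in the
  monomial of \<open>T\<close> passes exactly the smaller generators.\<close>

definition sign_below :: "nat \<Rightarrow> nat set \<Rightarrow> 'a::comm_ring_1" where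
  "sign_below k T = (- 1) ^ card {a \<in> T. a < k}"

definition lmul :: "nat \<Rightarrow> 'a::comm_ring_1 ext \<Rightarrow> 'a ext" where
  "lmul k x = (\<lambda>T. if k \<in> T then sign_below k T * x (T - {k}) else 0)"

definition contr :: "nat \<Rightarrow> 'a::comm_ring_1 ext \<Rightarrow> 'a ext" where
  "contr k x = (\<lambda>T. if k \<in> T then 0 else sign_below k T * x (insert k T))"

text \<open>On forms in generators below \<open>g\<close> this is right multiplication by
  \<open>h_g\<close>, where no sign arises.\<close>

definition rmul :: "nat \<Rightarrow> 'a::comm_ring_1 ext \<Rightarrow> 'a ext" where
  "rmul g x = (\<lambda>T. if g \<in> T then x (T - {g}) else 0)"

lemma sign_below_square [simp]: "sign_below k T * sign_below k T = (1::'a::comm_ring_1)"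
  by (simp add: sign_below_def flip: power_mult_distrib)

lemma sign_below_square_left [simp]: "sign_below k T * (sign_below k T * x) = (x::'a::comm_ring_1)"
  by (simp flip: mult.assoc)

lemma sign_below_insert: "b \<notin> T \<Longrightarrow> sign_below a (insert b T) = (if b < a then - sign_below a T else (sign_below a T :: 'a::comm_ring_1))"
proof -
  assume "b \<notin> T"
  have "{x \<in> insert b T. x < a} = (if b < a then insert b {x \<in> T. x < a} else {x \<in> T. x < a})"
    by auto
  then show ?thesis using \<open>b \<notin> T\<close> by (simp add: sign_below_def)
qed

lemma sign_below_remove: "b \<in> T \<Longrightarrow> sign_below a (T - {b}) = (if b < a then - sign_below a T else (sign_below a T :: 'a::comm_ring_1))"
  using sign_below_insert[of b "T - {b}" a, where ?'a = 'a] by (auto simp: insert_absorb split: if_splits)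

lemma lmul_add: "lmul k (x + y) = lmul k x + lmul k y"
  and lmul_diff: "lmul k (x - y) = lmul k x - lmul k y"
  and lmul_minus: "lmul k (- x) = - lmul k x"
  and lmul_zero: "lmul k 0 = 0"
  by (auto simp: lmul_def fun_eq_iff algebra_simps)

lemma contr_add: "contr k (x + y) = contr k x + contr k y"
  and contr_diff: "contr k (x - y) = contr k x - contr k y"
  and contr_minus: "contr k (- x) = - contr k x"
  and contr_zero: "contr k 0 = 0"
  by (auto simp: contr_def fun_eq_iff algebra_simps)

lemma rmul_add: "rmul k (x + y) = rmul k x + rmul k y"
  and rmul_diff: "rmul k (x - y) = rmul k x - rmul k y"
  and rmul_minus: "rmul k (- x) = - rmul k x"
  and rmul_zero: "rmul k 0 = 0"
  by (auto simp: rmul_def fun_eq_iff algebra_simps)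

lemmas op_linear = lmul_add lmul_diff lmul_minus lmul_zero contr_add contr_diff contr_minus contr_zero
  rmul_add rmul_diff rmul_minus rmul_zero

lemma Diff_Diff_commute: "T - {a} - {b} = T - {b} - {a}" for T :: "nat set"
  by auto

lemma insert_Diff_commute: "a \<noteq> b \<Longrightarrow> insert a T - {b} = insert a (T - {b})"
  by auto

lemma lmul_lmul: "a \<noteq> b \<Longrightarrow> lmul a (lmul b x) = - lmul b (lmul a x)"
  by (auto simp: lmul_def fun_eq_iff sign_below_remove Diff_Diff_commute)

lemma contr_contr: "a \<noteq> b \<Longrightarrow> contr a (contr b x) = - contr b (contr a x)"
  by (auto simp: contr_def fun_eq_iff sign_below_insert insert_commute)

lemma contr_same [simp]: "contr a (contr a x) = 0"
  by (auto simp: contr_def fun_eq_iff)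

lemma contr_lmul: "a \<noteq> b \<Longrightarrow> contr a (lmul b x) = - lmul b (contr a x)"
  by (auto simp: contr_def lmul_def fun_eq_iff sign_below_insert sign_below_remove insert_Diff_commute)

lemma contr_lmul_same: "contr a (lmul a x) = x - lmul a (contr a x)"
  by (auto simp: contr_def lmul_def fun_eq_iff sign_below_insert sign_below_remove insert_absorb)

lemma lmul_rmul: "a < g \<Longrightarrow> lmul a (rmul g x) = rmul g (lmul a x)"
  by (auto simp: lmul_def rmul_def fun_eq_iff sign_below_remove Diff_Diff_commute)

lemma contr_rmul: "a < g \<Longrightarrow> contr a (rmul g x) = rmul g (contr a x)"
  by (auto simp: contr_def rmul_def fun_eq_iff sign_below_remove insert_Diff_commute)

text \<open>The formulas of \<open>dh\<close> with every product put into increasing order, so that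
  the values at 10 and 11 are visibly the negatives of those at 8 and 9.\<close>

definition dgen_mul :: "nat \<Rightarrow> 'a::comm_ring_1 ext \<Rightarrow> 'a ext" where
  "dgen_mul k x =
    (if k = 8 then - lmul 0 (lmul 2 x)
     else if k = 9 then - lmul 1 (lmul 3 x)
     else if k = 10 then lmul 0 (lmul 2 x)
     else if k = 11 then lmul 1 (lmul 3 x)
     else if k = 12 then lmul 3 (lmul 4 x) - lmul 0 (lmul 6 x)
     else if k = 13 then lmul 0 (lmul 5 x) - lmul 1 (lmul 7 x)
     else if k = 14 then lmul 1 (lmul 6 x) - lmul 2 (lmul 4 x)
     else if k = 15 then lmul 2 (lmul 7 x) - lmul 3 (lmul 5 x)
     else 0)"

lemma dgen_mul_add: "dgen_mul k (x + y) = dgen_mul k x + dgen_mul k y"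
  and dgen_mul_diff: "dgen_mul k (x - y) = dgen_mul k x - dgen_mul k y"
  and dgen_mul_minus: "dgen_mul k (- x) = - dgen_mul k x"
  and dgen_mul_zero: "dgen_mul k 0 = 0"
  by (simp_all add: dgen_mul_def op_linear)

text \<open>\<open>dgen k\<close> is quadratic in generators below 8, so the two sign changes cancel
  when \<open>h_c\<close> passes it.\<close>

lemma dgen_mul_lmul: "8 \<le> c \<Longrightarrow> dgen_mul k (lmul c x) = lmul c (dgen_mul k x)"
  by (simp add: dgen_mul_def op_linear lmul_lmul[of _ c])

lemma dgen_mul_contr: "8 \<le> c \<Longrightarrow> dgen_mul k (contr c x) = contr c (dgen_mul k x)"
  by (simp add: dgen_mul_def op_linear contr_lmul)

lemma dgen_mul_rmul: "8 \<le> g \<Longrightarrow> dgen_mul k (rmul g x) = rmul g (dgen_mul k x)"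
  by (simp add: dgen_mul_def op_linear lmul_rmul)

section \<open>Signs in exterior products of monomials\<close>

lemma emult_linear:
  "emult x (- y) = - emult x y" "emult (- y) x = - emult y x"
  "emult x (y + z) = emult x y + emult x z"  "emult (y + z) x = emult y x + emult z x"
  "emult x (y - z) = emult x y - emult x z" "emult (y - z) x = emult y x - emult z x"
  "emult x 0 = 0" "emult 0 x = 0"
  by (auto simp: emult_def fun_eq_iff algebra_simps sum.distrib sum_negf sum_subtractf)

lemma emult_scale:
  "emult x (escale c y) = escale c (emult x y)" "emult (escale c y) x = escale c (emult y x)"
  by (auto simp: emult_def escale_def fun_eq_iff algebra_simps sum_distrib_left)

lemma emult_emon:
  assumes "A \<subseteq> gens" "B \<subseteq> gens"
  shows "emult (emon A) (emon B) = (if A \<inter> B = {} then escale ((-1) ^ inv_count A B) (emon (A \<union> B)) else (0 :: 'a::comm_ring_1 ext))"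
proof
  fix S :: "nat set"
  show "emult (emon A) (emon B) S = (if A \<inter> B = {} then escale ((-1) ^ inv_count A B) (emon (A \<union> B)) else (0 :: 'a ext)) S"
  proof (cases "S \<subseteq> gens")
    case True
    then have fin: "finite (Pow S)" by (auto simp: gens_def intro: finite_subset)
    have "emult (emon A) (emon B) S = (\<Sum>A'\<in>Pow S. if A' = A then (if S - A = B then (-1) ^ inv_count A B else 0) else (0::'a))"
      unfolding emult_def if_P[OF True] by (intro sum.cong) (auto simp: emon_def)
    also have "\<dots> = (if A \<subseteq> S \<and> S - A = B then (-1) ^ inv_count A B else 0)"
      using fin by (simp add: sum.delta)
    finally show ?thesis by (auto simp: escale_def emon_def)
  next
    case False
    then show ?thesis using assms by (auto simp: emult_def escale_def emon_def)
  qed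
qed

lemma lmul_emon: "lmul a (emon S) = (if a \<in> S then 0 else escale (sign_below a S) (emon (insert a S)))"
  by (auto simp: lmul_def emon_def escale_def fun_eq_iff sign_below_insert)

lemma contr_emon: "contr a (emon S) = (if a \<in> S then escale (sign_below a S) (emon (S - {a})) else 0)"
  by (auto simp: contr_def emon_def escale_def fun_eq_iff sign_below_remove)

lemma rmul_emon: "g \<notin> S \<Longrightarrow> rmul g (emon S) = emon (insert g S)"
  by (auto simp: rmul_def emon_def fun_eq_iff)

lemma op_scale: "lmul a (escale c x) = escale c (lmul a x)" "contr a (escale c x) = escale c (contr a x)"
  "rmul a (escale c x) = escale c (rmul a x)"
  by (auto simp: lmul_def contr_def rmul_def escale_def fun_eq_iff algebra_simps)

lemma escale_simps: "escale c 0 = 0" "escale 0 x = 0" "escale 1 x = x" "escale (-c) x = - escale c x" "escale c (- x) = - escale c x" "escale c (x + y) = escale c x + escale c y"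
  "escale c (x - y) = escale c x - escale c y" "escale c (escale d x) = escale (c * d) x"
  by (auto simp: escale_def fun_eq_iff algebra_simps)

lemma dgen_mul_scale: "dgen_mul k (escale c x) = escale c (dgen_mul k x)"
  by (simp add: dgen_mul_def op_scale escale_simps)

lemma inv_count_Un_right:
  assumes "finite A" "finite B" "finite C" "B \<inter> C = {}"
  shows "inv_count A (B \<union> C) = inv_count A B + inv_count A C"
proof -
  have "{(a, b). a \<in> A \<and> b \<in> B \<union> C \<and> b < a} = {(a, b). a \<in> A \<and> b \<in> B \<and> b < a} \<union> {(a, b). a \<in> A \<and> b \<in> C \<and> b < a}"
    by auto
  moreover have "finite {(a, b). a \<in> A \<and> b \<in> B \<and> b < a}" "finite {(a, b). a \<in> A \<and> b \<in> C \<and> b < a}"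
    by (rule finite_subset[of _ "A \<times> (B \<union> C)"]; use assms in auto)+
  ultimately show ?thesis
    using assms unfolding inv_count_def by (subst card_Un_disjoint[symmetric]) auto
qed

lemma inv_count_Un_left:
  assumes "finite A" "finite B" "finite C" "A \<inter> B = {}"
  shows "inv_count (A \<union> B) C = inv_count A C + inv_count B C"
proof -
  have "{(a, b). a \<in> A \<union> B \<and> b \<in> C \<and> b < a} = {(a, b). a \<in> A \<and> b \<in> C \<and> b < a} \<union> {(a, b). a \<in> B \<and> b \<in> C \<and> b < a}"
    by auto
  moreover have "finite {(a, b). a \<in> A \<and> b \<in> C \<and> b < a}" "finite {(a, b). a \<in> B \<and> b \<in> C \<and> b < a}"
    by (rule finite_subset[of _ "(A \<union> B) \<times> C"]; use assms in auto)+
  ultimately show ?thesis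
    using assms unfolding inv_count_def by (subst card_Un_disjoint[symmetric]) auto
qed

lemma sign_inv_count_singleton_left: "(- 1) ^ inv_count {a} B = (sign_below a B :: 'a::comm_ring_1)"
proof -
  have "{(x, b). x \<in> {a} \<and> b \<in> B \<and> b < x} = Pair a ` {b \<in> B. b < a}" by auto
  then show ?thesis by (simp add: inv_count_def sign_below_def card_image inj_on_def)
qed

text \<open>Every element of \<open>A\<close> lies above or below \<open>a\<close>, so the number
  above has the parity of \<open>card A\<close> plus the number below.\<close>

lemma sign_inv_count_singleton_right:
  assumes "finite A" "a \<notin> A"
  shows "(- 1) ^ inv_count A {a} = ((- 1) ^ card A * sign_below a A :: 'a::comm_ring_1)"
proof -
  have "{(x, b). x \<in> A \<and> b \<in> {a} \<and> b < x} = (\<lambda>x. (x, a)) ` {x \<in> A. a < x}" by auto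
  then have 1: "inv_count A {a} = card {x \<in> A. a < x}"
    by (simp add: inv_count_def card_image inj_on_def)
  have "A = {x \<in> A. x < a} \<union> {x \<in> A. a < x}" using assms(2) by (auto simp: not_less_iff_gr_or_eq)
  then have "card A = card ({x \<in> A. x < a} \<union> {x \<in> A. a < x})" by simp
  also have "\<dots> = card {x \<in> A. x < a} + card {x \<in> A. a < x}"
    using assms(1) by (intro card_Un_disjoint) auto
  finally show ?thesis by (simp add: 1 sign_below_def power_add mult.commute mult.left_commute flip: power_mult_distrib mult.assoc)
qed

text \<open>An even element may be moved to the front of a product, past the factor \<open>emon A\<close>.\<close>

lemma emult_pair:
  assumes A: "A \<subseteq> gens" and B: "B \<subseteq> gens" and AB: "\<And>x y. x \<in> A \<Longrightarrow> y \<in> B \<Longrightarrow> x < y"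
    and a: "a \<in> gens" and b: "b \<in> gens"
  shows "emult (emult (emon A) (emult (emon {a}) (emon {b}))) (emon B) = (lmul a (lmul b (emon (A \<union> B))) :: 'a::comm_ring_1 ext)"
proof (cases "a = b \<or> a \<in> A \<union> B \<or> b \<in> A \<union> B")
  case True
  \<comment> \<open>A repeated generator makes both sides vanish.\<close>
  with A B a b show ?thesis
    by (auto simp: emult_emon emult_linear emult_scale lmul_emon op_scale op_linear escale_simps)
next
  case False
  have fin: "finite A" "finite B" using A B by (auto simp: gens_def intro: finite_subset)
  have disj: "A \<inter> B = {}" using AB by auto
  have 0: "inv_count A B = 0"
  proof -
    have "{(x, y). x \<in> A \<and> y \<in> B \<and> y < x} = {}" using AB by fastforce
    then show ?thesis unfolding inv_count_def by (metis card.empty)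
  qed
  have sgAB: "sign_below k (A \<union> B) = (sign_below k A * sign_below k B :: 'a)" for k
  proof -
    have "{x \<in> A \<union> B. x < k} = {x \<in> A. x < k} \<union> {x \<in> B. x < k}" by auto
    then show ?thesis using fin disj unfolding sign_below_def power_add[symmetric]
      by (subst card_Un_disjoint[symmetric]) auto
  qed
  have sqA: "(- 1) ^ card A * ((- 1) ^ card A * x) = x" for x :: 'a
    by (simp flip: mult.assoc power_mult_distrib)
  \<comment> \<open>Each of the two generators contributes \<open>(- 1) ^ card A\<close> when it
    passes \<open>A\<close>; these signs cancel, which is the evenness of the pair.\<close>
  have inv1: "(- 1) ^ inv_count A {a, b} = (sign_below a A * sign_below b A :: 'a)"
    using inv_count_Un_right[of A "{a}" "{b}"] fin False
    by (simp add: power_add sign_inv_count_singleton_right mult_ac sqA insert_commute)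
  have "inv_count (A \<union> {a, b}) B = inv_count A B + (inv_count {a} B + inv_count {b} B)"
    using inv_count_Un_left[of A "{a, b}" B] inv_count_Un_left[of "{a}" "{b}" B] fin False
    by (simp add: insert_commute)
  then have inv2: "(- 1) ^ inv_count (A \<union> {a, b}) B = (sign_below a B * sign_below b B :: 'a)"
    by (simp add: 0 power_add sign_inv_count_singleton_left)
  have inv3: "(- 1) ^ inv_count {a} {b} = (sign_below a {b} :: 'a)"
    by (rule sign_inv_count_singleton_left)
  have sets: "A \<union> {a, b} \<union> B = insert a (insert b (A \<union> B))" by auto
  have "sign_below a {b} = (if b < a then - 1 else 1 :: 'a)"
    using sign_below_insert[of b "{}" a, where ?'a = 'a] by (simp add: sign_below_def)
  then have sgi: "sign_below a (insert b (A \<union> B)) = (sign_below a {b} * sign_below a (A \<union> B) :: 'a)"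
    using False by (simp add: sign_below_insert)
  have "emult (emult (emon A) (emult (emon {a}) (emon {b}))) (emon B)
      = escale (sign_below a {b} * (sign_below a A * sign_below b A) * (sign_below a B * sign_below b B)) (emon (A \<union> {a, b} \<union> B) :: 'a ext)"
    using False A B a b disj
    by (auto simp: emult_emon emult_linear emult_scale escale_simps inv1 inv2[simplified] inv3 insert_commute mult_ac)
  also have "\<dots> = lmul a (lmul b (emon (A \<union> B)))"
    using False by (simp add: lmul_emon op_scale escale_simps sets sgi sgAB mult_ac)
  finally show ?thesis .
qed

section \<open>The differential\<close>

lemma emult_dgen:
  assumes "A \<subseteq> gens" "B \<subseteq> gens" "\<And>x y. x \<in> A \<Longrightarrow> y \<in> B \<Longrightarrow> x < y" "k < 16"
  shows "emult (emult (emon A) (dgen k)) (emon B) = (dgen_mul k (emon (A \<union> B)) :: 'a::comm_ring_1 ext)"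
proof -
  have pair: "emult (emult (emon A) (emult (emon {a}) (emon {b}))) (emon B) = (lmul a (lmul b (emon (A \<union> B))) :: 'a ext)"
    if "a < 16" "b < 16" for a b
    using assms that by (intro emult_pair) (auto simp: gens_def)
  have "k = 0 \<or> k = 1 \<or> k = 2 \<or> k = 3 \<or> k = 4 \<or> k = 5 \<or> k = 6 \<or> k = 7 \<or> k = 8 \<or> k = 9 \<or> k = 10
      \<or> k = 11 \<or> k = 12 \<or> k = 13 \<or> k = 14 \<or> k = 15"
    using assms(4) by presburger
  then show ?thesis
    \<comment> \<open>The instances of \<open>lmul_lmul\<close> reorder exactly those products in
      \<open>dh\<close> whose first generator is the larger one.\<close>
    by (elim disjE)
      (simp_all add: dgen_def dh_def hgen_def gen_def ext_ops emult_linear pair dgen_mul_def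
        lmul_lmul[of 2 0] lmul_lmul[of 3 "Suc 0"] lmul_lmul[of 4 3] lmul_lmul[of 5 0] lmul_lmul[of 6 "Suc 0"]
        lmul_lmul[of 7 2] flip: numeral_2_eq_2)
qed

text \<open>The sign and the removal of \<open>k\<close> in the derivation formula are those of
  \<open>contr k\<close>; the even factor \<open>dgen k\<close> is then pulled to the front.\<close>

lemma ediff_basis_eq:
  assumes "S \<subseteq> gens"
  shows "ediff_basis S = (\<Sum>k\<in>gens. dgen_mul k (contr k (emon S)) :: 'a::comm_ring_1 ext)"
proof -
  have "finite gens" by (simp add: gens_def)
  have "ediff_basis S = (\<Sum>k\<in>S. dgen_mul k (contr k (emon S)) :: 'a ext)"
  proof
    fix T
    have "(- 1) ^ card {a \<in> S. a < k} * emult (emult (emon {a \<in> S. a < k}) (dgen k)) (emon {a \<in> S. k < a}) T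
        = (dgen_mul k (contr k (emon S)) :: 'a ext) T" if "k \<in> S" for k
    proof -
      have k: "k < 16" using that assms by (auto simp: gens_def)
      have S: "{a \<in> S. a < k} \<union> {a \<in> S. k < a} = S - {k}" by auto
      have "emult (emult (emon {a \<in> S. a < k}) (dgen k)) (emon {a \<in> S. k < a}) = (dgen_mul k (emon (S - {k})) :: 'a ext)"
        unfolding S[symmetric] using assms k by (intro emult_dgen) auto
      then show ?thesis using that by (simp add: contr_emon dgen_mul_scale) (simp add: escale_def sign_below_def)
    qed
    then show "ediff_basis S T = (\<Sum>k\<in>S. dgen_mul k (contr k (emon S)) :: 'a ext) T"
      by (simp add: ediff_basis_def sum_fun_apply)
  qed
  also have "\<dots> = (\<Sum>k\<in>gens. dgen_mul k (contr k (emon S)))"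
    using assms \<open>finite gens\<close> by (intro sum.mono_neutral_left) (auto simp: contr_emon dgen_mul_zero)
  finally show ?thesis .
qed

section \<open>Homogeneous forms and partial differentials\<close>

text \<open>The generator set is a parameter so that generators can be removed from the
  complex.\<close>

definition forms :: "nat set \<Rightarrow> nat \<Rightarrow> 'a::comm_ring_1 ext set" where
  "forms G n = {x. \<forall>S. x S \<noteq> 0 \<longrightarrow> S \<subseteq> G \<and> card S = n}"

lemma cochains_eq_forms: "cochains n = forms gens n"
  by (simp add: cochains_def forms_def)

text \<open>Generators outside \<open>K\<close> are treated as cocycles; the change of variables
  will shrink \<open>K\<close> to \<open>{8, 9, 12, 13, 14, 15}\<close>.\<close>

definition diff_on :: "nat set \<Rightarrow> 'a::comm_ring_1 ext \<Rightarrow> 'a ext" where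
  "diff_on K x = (\<Sum>k\<in>K. dgen_mul k (contr k x))"

lemma diff_on_add: "diff_on K (x + y) = diff_on K x + diff_on K y"
  and diff_on_diff: "diff_on K (x - y) = diff_on K x - diff_on K y"
  and diff_on_zero: "diff_on K 0 = 0"
  by (simp_all add: diff_on_def op_linear dgen_mul_add dgen_mul_diff dgen_mul_minus dgen_mul_zero sum.distrib sum_subtractf sum_negf)

lemma diff_on_scale: "diff_on K (escale c x) = escale c (diff_on K x)"
proof -
  have "escale c (\<Sum>k\<in>A. f k) = (\<Sum>k\<in>A. escale c (f k))" for A :: "nat set" and f :: "nat \<Rightarrow> 'a ext"
    by (rule additive_sum[of "escale c"]) (simp_all add: escale_simps)
  then show ?thesis by (simp add: diff_on_def op_scale dgen_mul_scale)
qed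

lemma diff_on_sum: "diff_on K (\<Sum>i\<in>I. f i) = (\<Sum>i\<in>I. diff_on K (f i))"
  by (rule additive_sum[of "diff_on K"]) (simp_all add: diff_on_zero diff_on_add)

lemma sum_emon:
  assumes "finite P" "\<And>S. x S \<noteq> 0 \<Longrightarrow> S \<in> P"
  shows "x = (\<Sum>S\<in>P. escale (x S) (emon S))"
proof
  fix T
  have "(\<Sum>S\<in>P. escale (x S) (emon S)) T = (\<Sum>S\<in>P. if S = T then x S else 0)"
    unfolding sum_fun_apply by (intro sum.cong) (auto simp: escale_def emon_def)
  also have "\<dots> = x T" using assms by auto
  finally show "x T = (\<Sum>S\<in>P. escale (x S) (emon S)) T" ..
qed

text \<open>Generators 0 to 7 are cocycles. The hypothesis on \<open>x\<close> matters because
  \<open>ediff\<close> reads only coefficients at subsets of \<open>gens\<close>.\<close>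

lemma ediff_eq_diff_on:
  assumes "x \<in> forms gens n"
  shows "ediff x = diff_on {8..<16} x"
proof -
  have fin: "finite (Pow gens)" by (simp add: gens_def)
  have "dgen_mul k y = 0" if "k < 8" for k and y :: "'a ext" using that by (simp add: dgen_mul_def)
  then have basis: "ediff_basis S = (diff_on {8..<16} (emon S) :: 'a ext)" if "S \<subseteq> gens" for S
    unfolding ediff_basis_eq[OF that] diff_on_def gens_def
    by (intro sum.mono_neutral_right) (auto simp: not_le)
  have "ediff x = (\<Sum>S\<in>Pow gens. escale (x S) (ediff_basis S))"
  proof
    fix T
    show "ediff x T = (\<Sum>S\<in>Pow gens. escale (x S) (ediff_basis S)) T"
      by (simp add: ediff_def sum_fun_apply) (simp add: escale_def)
  qed
  also have "\<dots> = diff_on {8..<16} (\<Sum>S\<in>Pow gens. escale (x S) (emon S))"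
    by (simp add: diff_on_sum diff_on_scale basis)
  also have "(\<Sum>S\<in>Pow gens. escale (x S) (emon S)) = x"
    using assms by (intro sum_emon[symmetric, OF fin]) (auto simp: forms_def)
  finally show ?thesis .
qed

section \<open>The change of variables\<close>

text \<open>For distinct \<open>a\<close>, \<open>b\<close> the map
  \<open>lmul a (contr b x)\<close> is a derivation of square zero, and this is its exponential: the
  algebra automorphism sending \<open>h_b\<close> to \<open>h_b + h_a\<close> and fixing the other
  generators.\<close>

definition shear :: "nat \<Rightarrow> nat \<Rightarrow> 'a::comm_ring_1 ext \<Rightarrow> 'a ext" where
  "shear a b x = x + lmul a (contr b x)"

lemma shear_add: "shear a b (x + y) = shear a b x + shear a b y"
  and shear_zero: "shear a b 0 = 0"
  by (simp_all add: shear_def op_linear)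

lemma shear_sum: "shear a b (\<Sum>i\<in>I. f i) = (\<Sum>i\<in>I. shear a b (f i))"
  by (rule additive_sum[of "shear a b"]) (simp_all add: shear_zero shear_add)

lemma dgen_mul_shear: "8 \<le> a \<Longrightarrow> 8 \<le> b \<Longrightarrow> dgen_mul k (shear a b x) = shear a b (dgen_mul k x)"
  by (simp add: shear_def dgen_mul_add dgen_mul_lmul dgen_mul_contr)

lemma contr_shear: "k \<noteq> a \<Longrightarrow> k \<noteq> b \<Longrightarrow> contr k (shear a b x) = shear a b (contr k x)"
  by (simp add: shear_def op_linear contr_lmul contr_contr[of k b])

text \<open>Chain rule for the substitution: \<open>contr a (shear a b x)\<close> has the extra
  summand \<open>contr b x\<close>, which the difference removes.\<close>

lemma contr_shear_diff:
  "a \<noteq> b \<Longrightarrow> contr a (shear a b x) - contr b (shear a b x) = shear a b (contr a x)"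
  by (simp add: shear_def op_linear contr_lmul contr_lmul_same contr_contr[of a b])

text \<open>Since \<open>dgen b\<close> is the negative of \<open>dgen a\<close>, the two summands
  combine to \<open>dgen a\<close> times \<open>contr a - contr b\<close>. The shear turns this into
  \<open>dgen a\<close> times \<open>contr a\<close>, and nothing is left of
  \<open>b\<close>.\<close>

lemma diff_on_shear:
  assumes "finite K" "a \<in> K" "b \<in> K" "a \<noteq> b" "8 \<le> a" "8 \<le> b" and dgen_mul: "\<And>y. dgen_mul b y = - dgen_mul a (y :: 'a::comm_ring_1 ext)"
  shows "diff_on K (shear a b x) = shear a b (diff_on (K - {b}) (x :: 'a ext))"
proof -
  have *: "diff_on K' y = dgen_mul a (contr a y) + (\<Sum>k\<in>K' - {a}. dgen_mul k (contr k y))" if "finite K'" "a \<in> K'" for K' and y :: "'a ext"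
    unfolding diff_on_def using that by (rule sum.remove)
  have "diff_on K (shear a b x) = dgen_mul a (contr a (shear a b x)) + (dgen_mul b (contr b (shear a b x))
      + (\<Sum>k\<in>K - {a} - {b}. dgen_mul k (contr k (shear a b x))))"
    using assms sum.remove[of "K - {a}" b "\<lambda>k. dgen_mul k (contr k (shear a b x))"] by (subst *) auto
  also have "\<dots> = dgen_mul a (contr a (shear a b x) - contr b (shear a b x)) + (\<Sum>k\<in>K - {a} - {b}. dgen_mul k (contr k (shear a b x)))"
    by (simp add: dgen_mul dgen_mul_diff)
  also have "\<dots> = shear a b (dgen_mul a (contr a x)) + (\<Sum>k\<in>K - {a} - {b}. shear a b (dgen_mul k (contr k x)))"
    using assms by (simp add: contr_shear_diff dgen_mul_shear contr_shear)
  also have "\<dots> = shear a b (diff_on (K - {b}) x)"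
    using assms by (subst *) (auto simp: shear_add shear_sum Diff_Diff_commute)
  finally show ?thesis .
qed

lemma diff_on_shear_shear:
  "diff_on {8..<16} (shear 8 10 (shear 9 11 x)) = shear 8 10 (shear 9 11 (diff_on {8, 9, 12, 13, 14, 15} x))"
proof -
  have "{8..<16} - {10} - {11::nat} = {8, 9, 12, 13, 14, 15}" by auto
  moreover have "diff_on {8..<16} (shear 8 10 (shear 9 11 x)) = shear 8 10 (diff_on ({8..<16} - {10}) (shear 9 11 x))"
    by (rule diff_on_shear) (simp_all add: dgen_mul_def)
  moreover have "diff_on ({8..<16} - {10}) (shear 9 11 x) = shear 9 11 (diff_on ({8..<16} - {10} - {11}) x)"
    by (rule diff_on_shear) (simp_all add: dgen_mul_def)
  ultimately show ?thesis by simp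
qed

lemma formsI: "(\<And>S. x S \<noteq> 0 \<Longrightarrow> S \<subseteq> G \<and> card S = n) \<Longrightarrow> x \<in> forms G n"
  by (simp add: forms_def)

lemma formsD: "x \<in> forms G n \<Longrightarrow> x S \<noteq> 0 \<Longrightarrow> S \<subseteq> G \<and> card S = n"
  by (simp add: forms_def)

lemma forms_zero: "0 \<in> forms G n"
  by (simp add: forms_def)

lemma forms_add: "x \<in> forms G n \<Longrightarrow> y \<in> forms G n \<Longrightarrow> x + y \<in> forms G n"
  unfolding forms_def by (simp, metis add_0)

lemma forms_scale: "x \<in> forms G n \<Longrightarrow> escale c x \<in> forms G n"
  unfolding forms_def escale_def by (simp, metis mult_zero_right)

lemma forms_diff: "x \<in> forms G n \<Longrightarrow> y \<in> forms G n \<Longrightarrow> x - y \<in> forms G n"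
  unfolding forms_def by (simp, metis diff_zero)

lemma lmul_forms:
  assumes "finite G" "x \<in> forms G n"
  shows "lmul a x \<in> forms (insert a G) (Suc n)"
proof (rule formsI)
  fix S assume "lmul a x S \<noteq> 0"
  then have "a \<in> S" "x (S - {a}) \<noteq> 0" by (auto simp: lmul_def split: if_splits)
  then have *: "a \<in> S" "S - {a} \<subseteq> G" "card (S - {a}) = n" using formsD[OF assms(2)] by auto
  have "finite (S - {a})" by (rule finite_subset[OF *(2) assms(1)])
  then have "finite S" by simp
  then show "S \<subseteq> insert a G \<and> card S = Suc n" using * card_Suc_Diff1[of S a] by auto
qed

lemma contr_forms:
  assumes "finite G" "x \<in> forms G (Suc n)"
  shows "contr a x \<in> forms (G - {a}) n"
proof (rule formsI)
  fix S assume "contr a x S \<noteq> 0"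
  then have "a \<notin> S" "x (insert a S) \<noteq> 0" by (auto simp: contr_def split: if_splits)
  then have *: "a \<notin> S" "insert a S \<subseteq> G" "card (insert a S) = Suc n" using formsD[OF assms(2)] by auto
  have "finite (insert a S)" by (rule finite_subset[OF *(2) assms(1)])
  then have "finite S" by simp
  then show "S \<subseteq> G - {a} \<and> card S = n" using * by (simp add: subset_Diff_insert)
qed

lemma contr_forms_0:
  assumes "finite G" "x \<in> forms G 0"
  shows "contr a x = 0"
proof
  fix S
  have "x (insert a S) = 0"
  proof (rule ccontr)
    assume "x (insert a S) \<noteq> 0"
    then have "insert a S \<subseteq> G" "card (insert a S) = 0" using formsD[OF assms(2)] by auto
    moreover from this(1) have "finite (insert a S)" using assms(1) by (rule finite_subset)
    ultimately show False by simp
  qed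
  then show "contr a x S = 0 S" by (simp add: contr_def)
qed

lemma shear_forms: "finite G \<Longrightarrow> a \<in> G \<Longrightarrow> x \<in> forms G n \<Longrightarrow> shear a b x \<in> forms G n"
proof (cases n)
  case 0
  assume "finite G" "x \<in> forms G n"
  with 0 show ?thesis by (simp add: shear_def contr_forms_0 lmul_zero)
next
  case (Suc m)
  assume *: "finite G" "a \<in> G" "x \<in> forms G n"
  then have "contr b x \<in> forms (G - {b}) m" using contr_forms Suc by blast
  then have "lmul a (contr b x) \<in> forms (insert a (G - {b})) n" using lmul_forms Suc * by blast
  then have "lmul a (contr b x) \<in> forms G n" using * by (auto simp: forms_def)
  with * show ?thesis by (simp add: shear_def forms_add)
qed

text \<open>The operator added to the identity squares to zero, so subtracting it inverts the
  shear.\<close>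

lemma shear_inverse: "a \<noteq> b \<Longrightarrow> shear a b (x - lmul a (contr b x)) = x" "a \<noteq> b \<Longrightarrow> shear a b x - lmul a (contr b (shear a b x)) = x"
  by (simp_all add: shear_def op_linear contr_lmul)

lemma shear_inj: "a \<noteq> b \<Longrightarrow> inj (shear a b)"
  by (metis injI shear_inverse(2))

lemma shear_image_forms:
  assumes "finite G" "a \<in> G" "a \<noteq> b"
  shows "shear a b ` forms G n = (forms G n :: 'b::comm_ring_1 ext set)"
proof
  show "shear a b ` forms G n \<subseteq> (forms G n :: 'b ext set)" using assms shear_forms by blast
  show "(forms G n :: 'b ext set) \<subseteq> shear a b ` forms G n"
  proof
    fix x :: "'b ext" assume x: "x \<in> forms G n"
    then have "shear a b x \<in> forms G n" using assms shear_forms by blast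
    \<comment> \<open>\<open>shear a b x - x\<close> is \<open>lmul a (contr b x)\<close>, so this
      is the inverse shear applied to \<open>x\<close>.\<close>
    then have "x - (shear a b x - x) \<in> forms G n" using x forms_diff by blast
    then show "x \<in> shear a b ` forms G n"
      using shear_inverse(1)[OF assms(3), of x] by (intro image_eqI[of _ _ "x - lmul a (contr b x)"]) (auto simp: shear_def)
  qed
qed

text \<open>Both shears permute \<open>forms gens n\<close> and are injective, so they carry one
  image bijectively onto the other.\<close>

lemma card_ediff_image:
  "card (ediff ` (forms gens n :: 'a ext set)) = card (diff_on {8, 9, 12, 13, 14, 15} ` (forms gens n :: 'a::comm_ring_1 ext set))"
proof -
  have gens: "finite gens" "8 \<in> gens" "9 \<in> gens" by (auto simp: gens_def)
  have "ediff ` forms gens n = diff_on {8..<16} ` (forms gens n :: 'a ext set)"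
    using ediff_eq_diff_on by (intro image_cong) auto
  also have "\<dots> = diff_on {8..<16} ` shear 8 10 ` shear 9 11 ` (forms gens n :: 'a ext set)"
    using gens by (simp add: shear_image_forms)
  also have "\<dots> = shear 8 10 ` shear 9 11 ` diff_on {8, 9, 12, 13, 14, 15} ` (forms gens n :: 'a ext set)"
    by (simp add: image_image diff_on_shear_shear)
  finally show ?thesis
    using shear_inj[of 8 10, where ?'a = 'a] shear_inj[of 9 11, where ?'a = 'a]
    by (simp add: card_image inj_on_subset[OF _ subset_UNIV])
qed

section \<open>Splitting off an exterior generator\<close>

lemma diff_on_lmul: "8 \<le> c \<Longrightarrow> c \<notin> K \<Longrightarrow> diff_on K (lmul c x) = - lmul c (diff_on K x)"
proof -
  assume c: "8 \<le> c" "c \<notin> K"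
  have sum: "lmul c (\<Sum>k\<in>A. f k) = (\<Sum>k\<in>A. lmul c (f k))" for A and f :: "nat \<Rightarrow> 'a ext"
    by (rule additive_sum[of "lmul c"]) (simp_all add: op_linear)
  have "dgen_mul k (contr k (lmul c x)) = - lmul c (dgen_mul k (contr k x))" if "k \<in> K" for k
    using c that by (subst contr_lmul) (auto simp: dgen_mul_lmul dgen_mul_minus)
  then show ?thesis by (simp add: diff_on_def sum sum_negf)
qed

lemma contr_diff_on: "8 \<le> c \<Longrightarrow> c \<notin> K \<Longrightarrow> contr c (diff_on K x) = - diff_on K (contr c x)"
proof -
  assume c: "8 \<le> c" "c \<notin> K"
  have sum: "contr c (\<Sum>k\<in>A. f k) = (\<Sum>k\<in>A. contr c (f k))" for A and f :: "nat \<Rightarrow> 'a ext"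
    by (rule additive_sum[of "contr c"]) (simp_all add: op_linear)
  have "dgen_mul k (contr k (contr c x)) = - contr c (dgen_mul k (contr k x))" if "k \<in> K" for k
    using c that by (subst contr_contr) (auto simp: dgen_mul_contr dgen_mul_minus)
  then show ?thesis by (simp add: diff_on_def sum sum_negf)
qed

lemma contr_off:
  assumes "c \<notin> G" "x \<in> forms G n"
  shows "contr c x = 0"
proof
  fix T
  have "x (insert c T) = 0" using formsD[OF assms(2), of "insert c T"] assms(1) by blast
  then show "contr c x T = 0 T" by (simp add: contr_def)
qed

text \<open>The generator \<open>c\<close> splits off as an exterior factor with zero differential.\<close>

lemma card_diff_on_image_insert:
  fixes G :: "nat set" and n :: nat
  assumes "finite G" "c \<notin> G" "8 \<le> c" "c \<notin> K"
  defines "X \<equiv> \<lambda>m. diff_on K ` (forms G m :: 'a::comm_ring_1 ext set)"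
  shows "card (diff_on K ` (forms (insert c G) (Suc n) :: 'a ext set)) = card (X (Suc n)) * card (X n)"
    and "diff_on K ` (forms (insert c G) 0 :: 'a ext set) = X 0"
proof -
  let ?f = "\<lambda>(u, v). u - lmul c v :: 'a ext"
  have off: "contr c u = 0" if "u \<in> X m" for u m
    using that assms by (auto simp: X_def contr_diff_on contr_off diff_on_zero)
  have "diff_on K ` (forms (insert c G) (Suc n) :: 'a ext set) = ?f ` (X (Suc n) \<times> X n)"
  proof (intro equalityI subsetI)
    fix w assume "w \<in> diff_on K ` (forms (insert c G) (Suc n) :: 'a ext set)"
    then obtain x where x: "x \<in> forms (insert c G) (Suc n)" "w = diff_on K x" by auto
    \<comment> \<open>\<open>z\<close> collects the terms containing \<open>c\<close>: in
      \<open>x = (x - lmul c z) + lmul c z\<close> both \<open>z\<close> and the first summand are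
      free of \<open>c\<close>.\<close>
    define z where "z = contr c x"
    have z: "z \<in> forms G n" using contr_forms[OF _ x(1), of c] assms by (simp add: z_def)
    have "lmul c z \<in> forms (insert c G) (Suc n)" using lmul_forms z assms(1) by blast
    then have y: "x - lmul c z \<in> forms (insert c G) (Suc n)" using x forms_diff by blast
    have yT: "(x - lmul c z) T = 0" if "c \<in> T" for T
      using that by (simp add: z_def lmul_def contr_def sign_below_remove insert_absorb)
    have "x - lmul c z \<in> forms G (Suc n)"
      using y yT unfolding forms_def by blast
    then have "diff_on K (x - lmul c z) \<in> X (Suc n)" "diff_on K z \<in> X n" using z by (auto simp: X_def)
    moreover have "w = ?f (diff_on K (x - lmul c z), diff_on K z)"
      using assms x by (simp add: diff_on_diff diff_on_lmul)
    ultimately show "w \<in> ?f ` (X (Suc n) \<times> X n)" by blast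
  next
    fix w assume "w \<in> ?f ` (X (Suc n) \<times> X n)"
    then obtain y z where yz: "y \<in> forms G (Suc n)" "z \<in> forms G n" "w = diff_on K y - lmul c (diff_on K z)"
      by (auto simp: X_def)
    have "y \<in> forms (insert c G) (Suc n)" using yz(1) by (auto simp: forms_def)
    then have "y + lmul c z \<in> forms (insert c G) (Suc n)" using lmul_forms yz assms(1) forms_add by blast
    moreover have "w = diff_on K (y + lmul c z)" using yz assms by (simp add: diff_on_add diff_on_lmul)
    ultimately show "w \<in> diff_on K ` forms (insert c G) (Suc n)" by blast
  qed
  moreover have "inj_on ?f (X (Suc n) \<times> X n)"
  proof (rule inj_onI, clarify)
    fix u v u' v' assume *: "u \<in> X (Suc n)" "v \<in> X n" "u' \<in> X (Suc n)" "v' \<in> X n"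
      and eq: "u - lmul c v = u' - lmul c v'"
    \<comment> \<open>By \<open>off\<close>, contraction with \<open>c\<close> kills
      \<open>u\<close> and \<open>v\<close>, so it recovers \<open>v\<close> from the
      difference.\<close>
    have "contr c (u - lmul c v) = - v" "contr c (u' - lmul c v') = - v'"
      using * by (simp_all add: op_linear contr_lmul_same off)
    then have "v = v'" using eq by simp
    with eq show "u = u' \<and> v = v'" by simp
  qed
  ultimately show "card (diff_on K ` (forms (insert c G) (Suc n) :: 'a ext set)) = card (X (Suc n)) * card (X n)"
    by (simp add: card_image card_cartesian_product)
  have "forms (insert c G) 0 = (forms G 0 :: 'a ext set)"
  proof -
    \<comment> \<open>Infinite sets also have \<open>card S = 0\<close>; finiteness of
      \<open>G\<close> excludes them.\<close>
    have "S \<subseteq> insert c G \<and> card S = 0 \<longleftrightarrow> S \<subseteq> G \<and> card S = 0" for S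
      using assms(1) finite_subset[of S "insert c G"] by auto
    then show ?thesis by (simp add: forms_def)
  qed
  then show "diff_on K ` (forms (insert c G) 0 :: 'a ext set) = X 0" by (simp add: X_def)
qed

section \<open>Dimensions by counting\<close>

text \<open>Each vector of the larger span is uniquely \<open>k b + y\<close> with \<open>y\<close>
  in \<open>span B\<close>: two different values of \<open>k\<close> would put \<open>b\<close> into
  \<open>span B\<close>.\<close>

lemma (in vector_space) card_span_independent:
  assumes "finite B" "independent B"
  shows "card (span B) = card (UNIV :: 'a set) ^ card B"
  using assms
proof (induction B rule: finite_induct)
  case empty
  then show ?case by simp
next
  case (insert b B)
  then have ind: "independent B" "b \<notin> span B"
    by (simp_all add: independent_insert)
  let ?f = "\<lambda>(k, y). scale k b + y"
  have "span (insert b B) = ?f ` (UNIV \<times> span B)"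
  proof (intro equalityI subsetI)
    fix x assume "x \<in> span (insert b B)"
    then obtain k where "x - scale k b \<in> span B" by (auto simp: span_insert)
    then show "x \<in> ?f ` (UNIV \<times> span B)"
      by (intro image_eqI[of _ _ "(k, x - scale k b)"]) auto
  next
    fix x assume "x \<in> ?f ` (UNIV \<times> span B)"
    then obtain k y where "x = scale k b + y" "y \<in> span B" by auto
    then have "x - scale k b \<in> span B" by simp
    then show "x \<in> span (insert b B)" unfolding span_insert by blast
  qed
  moreover have "inj_on ?f (UNIV \<times> span B)"
  proof (rule inj_onI, clarify)
    fix k y k' y' assume y: "y \<in> span B" "y' \<in> span B" and eq: "scale k b + y = scale k' b + y'"
    then have diff: "scale (k - k') b = y' - y" by (simp add: scale_left_diff_distrib algebra_simps)
    have "k = k'"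
    proof (rule ccontr)
      assume "k \<noteq> k'"
      then have "b = scale (inverse (k - k')) (y' - y)" by (simp flip: diff)
      also have "\<dots> \<in> span B" using y by (intro span_scale span_diff)
      finally show False using ind by simp
    qed
    with eq show "k = k' \<and> y = y'" by simp
  qed
  ultimately show ?case using insert ind by (simp add: card_image card_cartesian_product)
qed

lemma (in vector_space) card_subspace:
  assumes "subspace V" "finite V"
  shows "card V = card (UNIV :: 'a set) ^ dim V"
proof -
  obtain B where B: "B \<subseteq> V" "independent B" "V \<subseteq> span B" "card B = dim V"
    using basis_exists by blast
  have "span B = V" using B assms(1) span_subspace by blast
  moreover have "finite B" using B assms(2) finite_subset by blast
  ultimately show ?thesis using card_span_independent[of B] B by simp
qed

interpretation ext: vector_space "escale :: 'a::field \<Rightarrow> 'a ext \<Rightarrow> 'a ext"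
  by unfold_locales (auto simp: escale_def fun_eq_iff algebra_simps)

lemma card_forms:
  assumes "finite G"
  shows "card (forms G n :: 'a::{field,finite} ext set) = card (UNIV :: 'a set) ^ (card G choose n)"
proof -
  define P where "P = {S. S \<subseteq> G \<and> card S = n}"
  have P: "finite P" "card P = card G choose n" using assms by (auto simp: P_def n_subsets)
  have "bij_betw (\<lambda>x. restrict x P) (forms G n :: 'a ext set) (P \<rightarrow>\<^sub>E UNIV)"
  proof (rule bij_betw_byWitness[where f' = "\<lambda>f S. if S \<in> P then f S else 0"])
    show "\<forall>x\<in>(forms G n :: 'a ext set). (\<lambda>S. if S \<in> P then restrict x P S else 0) = x"
      by (auto simp: forms_def P_def fun_eq_iff)
    show "\<forall>f\<in>P \<rightarrow>\<^sub>E (UNIV :: 'a set). restrict (\<lambda>S. if S \<in> P then f S else 0) P = f"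
      by (auto simp: fun_eq_iff PiE_def extensional_def)
    show "(\<lambda>x. restrict x P) ` (forms G n :: 'a ext set) \<subseteq> P \<rightarrow>\<^sub>E UNIV" by auto
    show "(\<lambda>f S. if S \<in> P then f S else 0) ` (P \<rightarrow>\<^sub>E (UNIV :: 'a set)) \<subseteq> forms G n"
      by (auto simp: forms_def P_def split: if_splits)
  qed
  then have "card (forms G n :: 'a ext set) = card (P \<rightarrow>\<^sub>E (UNIV :: 'a set))" by (rule bij_betw_same_card)
  also have "\<dots> = card (UNIV :: 'a set) ^ (card G choose n)" using P by (simp add: card_funcsetE)
  finally show ?thesis .
qed

lemma finite_forms: "finite G \<Longrightarrow> finite (forms G n :: 'a::{field,finite} ext set)"
  using card_forms[of G n, where ?'a = 'a] by (intro card_ge_0_finite) (simp add: finite_UNIV_card_ge_0)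

text \<open>Rank-nullity by counting: all nonempty fibres are translates of the kernel.\<close>

lemma card_additive_image:
  fixes f :: "'b::ab_group_add \<Rightarrow> 'c::ab_group_add"
  assumes "finite V" and diff: "\<And>x y. x \<in> V \<Longrightarrow> y \<in> V \<Longrightarrow> x - y \<in> V" "\<And>x y. x \<in> V \<Longrightarrow> y \<in> V \<Longrightarrow> x + y \<in> V"
    and f: "\<And>x y. x \<in> V \<Longrightarrow> y \<in> V \<Longrightarrow> f (x + y) = f x + f y"
  shows "card V = card {x \<in> V. f x = 0} * card (f ` V)"
proof -
  have fibre: "card {x \<in> V. f x = y} = card {x \<in> V. f x = 0}" if "y \<in> f ` V" for y
  proof -
    obtain v where v: "v \<in> V" "y = f v" using \<open>y \<in> f ` V\<close> by auto
    have fd: "f (x - v) = f x - f v" if "x \<in> V" for x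
      using f[of "x - v" v] diff(1)[OF that v(1)] v(1) by (simp add: algebra_simps)
    have "bij_betw (\<lambda>x. x + v) {x \<in> V. f x = 0} {x \<in> V. f x = y}"
    proof (rule bij_betw_byWitness[where f' = "\<lambda>x. x - v"])
      show "(\<lambda>x. x + v) ` {x \<in> V. f x = 0} \<subseteq> {x \<in> V. f x = y}" using v diff f by auto
      show "(\<lambda>x. x - v) ` {x \<in> V. f x = y} \<subseteq> {x \<in> V. f x = 0}" using v diff fd by auto
    qed simp_all
    then show ?thesis by (rule bij_betw_same_card[symmetric])
  qed
  have "card V = (\<Sum>y\<in>f ` V. card {x \<in> V. f x = y})"
    using sum.image_gen[OF assms(1), of "\<lambda>_. 1::nat" f] by simp
  then show ?thesis by (simp add: fibre)
qed

text \<open>Translation by 1 permutes the field, so comparing the sums over it shows that its size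
  is 0 in it. A prime size is therefore the characteristic.\<close>

lemma of_nat_nonzero:
  assumes "prime (card (UNIV :: 'a::{field,finite} set))" "0 < k" "k < card (UNIV :: 'a set)"
  shows "of_nat k \<noteq> (0 :: 'a)"
proof -
  have "(\<Sum>y\<in>UNIV. y + 1 :: 'a) = (\<Sum>y\<in>UNIV. y)"
    by (rule sum.reindex_bij_witness[of _ "\<lambda>y. y - 1" "\<lambda>y. y + 1"]) auto
  then have "of_nat (card (UNIV :: 'a set)) = (0 :: 'a)" by (simp add: sum.distrib)
  then have "CHAR('a) dvd card (UNIV :: 'a set)" by (simp add: of_nat_eq_0_iff_char_dvd)
  moreover have "CHAR('a) \<noteq> 1" by simp
  ultimately have "CHAR('a) = card (UNIV :: 'a set)" using assms(1) by (metis prime_nat_iff)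
  then show ?thesis using assms by (auto simp: of_nat_eq_0_iff_char_dvd dest: dvd_imp_le)
qed

section \<open>Sparse elimination\<close>

text \<open>
  A \<open>trie\<close> of depth \<open>n\<close> represents an element of the exterior algebra on \<open>n\<close> generators:
  \<open>Node a b\<close> stands for \<open>a + b \<cdot> h\<close>, where \<open>h\<close> is the largest generator. Multiplying by \<open>h\<close> on the
  right produces no signs. A \<open>tab\<close> stores rows in echelon form, each under the path of its leading
  monomial.
\<close>

datatype trie = Zero | Coef int | Node trie trie
datatype tab = Empty | Pivot int trie | Fork tab tab
datatype lookup = Miss | Hit int int trie

text \<open>Never builds \<open>Node Zero Zero\<close>, so zero has one representation and leading
  terms are found by descent. Splitting on constructors instead of testing equality makes every
  equation an unconditional rewrite rule.\<close>

fun node :: "trie \<Rightarrow> trie \<Rightarrow> trie" where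
  "node Zero Zero = Zero"
| "node Zero (Coef c) = Node Zero (Coef c)"
| "node Zero (Node a b) = Node Zero (Node a b)"
| "node (Coef c) b = Node (Coef c) b"
| "node (Node a a') b = Node (Node a a') b"

definition coef :: "int \<Rightarrow> trie" where
  "coef c = (if c = 0 then Zero else Coef c)"

fun scale_trie :: "int \<Rightarrow> trie \<Rightarrow> trie" where
  "scale_trie k Zero = Zero"
| "scale_trie k (Coef c) = Coef (k * c)"
| "scale_trie k (Node a b) = Node (scale_trie k a) (scale_trie k b)"

fun neg_trie :: "trie \<Rightarrow> trie" where
  "neg_trie Zero = Zero"
| "neg_trie (Coef c) = Coef (- c)"
| "neg_trie (Node a b) = Node (neg_trie a) (neg_trie b)"

text \<open>The last equation covers tries of different depth, which \<open>trie_ok\<close> rules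
  out.\<close>

fun sub_mult :: "int \<Rightarrow> trie \<Rightarrow> trie \<Rightarrow> trie" where
  "sub_mult f q Zero = q"
| "sub_mult f Zero (Coef c) = scale_trie (- f) (Coef c)"
| "sub_mult f Zero (Node a b) = scale_trie (- f) (Node a b)"
| "sub_mult f (Coef c) (Coef d) = coef (c - f * d)"
| "sub_mult f (Node a b) (Node c d) = node (sub_mult f a c) (sub_mult f b d)"
| "sub_mult f _ _ = Zero"

text \<open>The left branch is preferred, so the leading monomial is the least one when monomials
  are compared from the largest generator downwards.\<close>

fun lead_val :: "trie \<Rightarrow> int" where
  "lead_val Zero = 0"
| "lead_val (Coef c) = c"
| "lead_val (Node Zero b) = lead_val b"
| "lead_val (Node (Coef c) b) = c"
| "lead_val (Node (Node x y) b) = lead_val (Node x y)"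

fun find_pivot :: "trie \<Rightarrow> tab \<Rightarrow> lookup" where
  "find_pivot q Empty = Miss"
| "find_pivot (Coef f) (Pivot p r) = Hit f p r"
| "find_pivot (Node Zero b) (Fork l r) = find_pivot b r"
| "find_pivot (Node (Coef c) b) (Fork l r) = find_pivot (Coef c) l"
| "find_pivot (Node (Node x y) b) (Fork l r) = find_pivot (Node x y) l"
| "find_pivot _ _ = Miss"

text \<open>\<open>w\<close> is the whole row to be stored; the second argument starts as
  \<open>w\<close> and shrinks along the path of the leading monomial.\<close>

fun insert_pivot :: "trie \<Rightarrow> trie \<Rightarrow> tab \<Rightarrow> tab" where
  "insert_pivot w (Coef f) T = Pivot f w"
| "insert_pivot w (Node Zero b) (Fork l r) = Fork l (insert_pivot w b r)"
| "insert_pivot w (Node Zero b) Empty = Fork Empty (insert_pivot w b Empty)"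
| "insert_pivot w (Node (Coef c) b) (Fork l r) = Fork (insert_pivot w (Coef c) l) r"
| "insert_pivot w (Node (Coef c) b) Empty = Fork (insert_pivot w (Coef c) Empty) Empty"
| "insert_pivot w (Node (Node x y) b) (Fork l r) = Fork (insert_pivot w (Node x y) l) r"
| "insert_pivot w (Node (Node x y) b) Empty = Fork (insert_pivot w (Node x y) Empty) Empty"
| "insert_pivot w _ T = T"

text \<open>With positive pivots, the equations for positive numerals in
  \<open>reduce_by_eval\<close> and \<open>unit_pivot_eval\<close> suffice.\<close>

definition make_pos :: "int \<Rightarrow> trie \<Rightarrow> trie" where
  "make_pos l q = (if l < 0 then neg_trie q else q)"

definition insert_row :: "trie \<Rightarrow> tab \<Rightarrow> tab" where
  "insert_row w T = insert_pivot w w T"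

text \<open>Cross-multiplication in place of division: \<open>f\<close> is the leading coefficient
  of \<open>q\<close> and \<open>p\<close> the pivot of \<open>r\<close>, so the leading terms
  cancel.\<close>

definition reduce_by :: "int \<Rightarrow> int \<Rightarrow> trie \<Rightarrow> trie \<Rightarrow> trie" where
  "reduce_by p f q r = sub_mult f (scale_trie p q) r"

text \<open>The first argument bounds the number of reduction steps for one row.\<close>

fun add_row :: "nat \<Rightarrow> trie \<Rightarrow> tab \<Rightarrow> tab option" and add_found :: "nat \<Rightarrow> trie \<Rightarrow> tab \<Rightarrow> lookup \<Rightarrow> tab option" where
  "add_row i Zero T = Some T"
| "add_row i (Coef c) T = add_found i (Coef c) T (find_pivot (Coef c) T)"
| "add_row i (Node a b) T = add_found i (Node a b) T (find_pivot (Node a b) T)"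
| "add_found i q T Miss = Some (insert_row (make_pos (lead_val q) q) T)"
| "add_found (Suc i) q T (Hit f p r) = add_row i (reduce_by p f q r) T"
| "add_found 0 q T (Hit f p r) = None"

fun add_rows :: "nat \<Rightarrow> trie list \<Rightarrow> tab option \<Rightarrow> tab option" where
  "add_rows i [] T = T"
| "add_rows i (q # qs) None = None"
| "add_rows i (q # qs) (Some T) = add_rows i qs (add_row i q T)"

section \<open>Meaning and well-formedness of tries\<close>

text \<open>\<open>gs\<close> lists the generators from the root downwards, in use the largest
  first; a mismatch of depth gives 0.\<close>

fun trie_val :: "nat list \<Rightarrow> trie \<Rightarrow> 'a::comm_ring_1 ext" where
  "trie_val gs Zero = 0"
| "trie_val [] (Coef c) = escale (of_int c) (emon {})"
| "trie_val (g # gs) (Coef c) = 0"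
| "trie_val [] (Node a b) = 0"
| "trie_val (g # gs) (Node a b) = trie_val gs a + rmul g (trie_val gs b)"

fun trie_ok :: "nat \<Rightarrow> trie \<Rightarrow> bool" where
  "trie_ok n Zero = True"
| "trie_ok 0 (Coef c) = (c \<noteq> 0)"
| "trie_ok (Suc n) (Coef c) = False"
| "trie_ok 0 (Node a b) = False"
| "trie_ok (Suc n) (Node a b) = (trie_ok n a \<and> trie_ok n b \<and> \<not> (a = Zero \<and> b = Zero))"

lemma trie_ok_Coef: "trie_ok n (Coef c) \<longleftrightarrow> n = 0 \<and> c \<noteq> 0"
  by (cases n) auto

lemma trie_ok_Node: "trie_ok n (Node a b) \<longleftrightarrow> (\<exists>m. n = Suc m \<and> trie_ok m a \<and> trie_ok m b \<and> \<not> (a = Zero \<and> b = Zero))"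
  by (cases n) auto

lemma trie_ok_node: "trie_ok n a \<Longrightarrow> trie_ok n b \<Longrightarrow> trie_ok (Suc n) (node a b)"
  by (cases "(a, b)" rule: node.cases) auto

lemma trie_val_node: "trie_val (g # gs) (node a b) = trie_val gs a + rmul g (trie_val gs b)"
  by (cases "(a, b)" rule: node.cases) (auto simp: op_linear)

lemma scale_trie_Zero_iff [simp]: "scale_trie k v = Zero \<longleftrightarrow> v = Zero"
  by (cases v) auto

lemma trie_ok_scale_trie: "k \<noteq> 0 \<Longrightarrow> trie_ok n v \<Longrightarrow> trie_ok n (scale_trie k v)"
  by (induction n v rule: trie_ok.induct) auto

lemma trie_val_scale_trie: "trie_val gs (scale_trie k v) = escale (of_int k) (trie_val gs v)"
proof
  fix T
  show "trie_val gs (scale_trie k v) T = escale (of_int k) (trie_val gs v) T"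
    by (induction gs v arbitrary: T rule: trie_val.induct) (auto simp: escale_def rmul_def algebra_simps)
qed

lemma neg_trie_eq_scale_trie: "neg_trie v = scale_trie (- 1) v"
  by (induction v) auto

lemma trie_ok_neg_trie: "trie_ok n v \<Longrightarrow> trie_ok n (neg_trie v)"
  by (simp add: neg_trie_eq_scale_trie trie_ok_scale_trie)

lemma trie_val_neg_trie: "trie_val gs (neg_trie v) = - trie_val gs v"
  by (simp add: neg_trie_eq_scale_trie trie_val_scale_trie escale_simps)

lemma trie_ok_sub_mult: "f \<noteq> 0 \<Longrightarrow> trie_ok n q \<Longrightarrow> trie_ok n r \<Longrightarrow> trie_ok n (sub_mult f q r)"
proof (induction f q r arbitrary: n rule: sub_mult.induct)
  case (4 f c d)
  then show ?case by (cases n) (auto simp: coef_def)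
next
  case (5 f a b c d)
  then show ?case by (cases n) (auto simp: trie_ok_node)
qed (auto simp: trie_ok_scale_trie simp del: scale_trie.simps)

lemma trie_val_sub_mult:
  assumes "trie_ok (length gs) q" "trie_ok (length gs) r"
  shows "trie_val gs (sub_mult f q r) = trie_val gs q - escale (of_int f) (trie_val gs r)"
proof
  fix T
  show "trie_val gs (sub_mult f q r) T = (trie_val gs q - escale (of_int f) (trie_val gs r)) T"
    using assms
  proof (induction f q r arbitrary: gs T rule: sub_mult.induct)
    case (4 f c d)
    then show ?case
      by (cases gs) (auto simp: coef_def escale_def emon_def algebra_simps simp flip: of_int_mult)
  next
    case (5 f a b c d)
    then show ?case
      by (cases gs) (auto simp: trie_val_node rmul_def escale_def algebra_simps)
  qed (auto simp: trie_val_scale_trie escale_def trie_ok_Coef trie_ok_Node simp del: scale_trie.simps)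
qed

lemma trie_val_support: "trie_val gs v T \<noteq> (0 :: 'a::comm_ring_1) \<Longrightarrow> T \<subseteq> set gs"
proof (induction gs v arbitrary: T rule: trie_val.induct)
  case (5 g gs a b)
  then have "trie_val gs a T \<noteq> (0 :: 'a) \<or> (g \<in> T \<and> trie_val gs b (T - {g}) \<noteq> (0 :: 'a))"
    by (auto simp: rmul_def split: if_splits)
  then show ?case using 5 by fastforce
qed (auto simp: escale_def emon_def split: if_splits)

fun lead :: "nat list \<Rightarrow> trie \<Rightarrow> nat set" where
  "lead (g # gs) (Node a b) = (if a = Zero then insert g (lead gs b) else lead gs a)"
| "lead _ _ = {}"

lemma lead_subset: "lead gs v \<subseteq> set gs"
  by (induction gs v rule: lead.induct) auto

lemma lead_val_Node: "lead_val (Node a b) = (if a = Zero then lead_val b else lead_val a)"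
  by (cases a) auto

lemma lead_val_nonzero: "trie_ok n v \<Longrightarrow> v \<noteq> Zero \<Longrightarrow> lead_val v \<noteq> 0"
  by (induction n v rule: trie_ok.induct) (auto simp: lead_val_Node)

lemma set_encode_less:
  assumes "finite A" "\<And>x. x \<in> A \<Longrightarrow> x < g"
  shows "set_encode A < 2 ^ g"
proof -
  have "set_encode A \<le> (\<Sum>i<g. 2 ^ i)"
    unfolding set_encode_def using assms by (intro sum_mono2) auto
  also have "\<dots> < (2::nat) ^ g" by (simp add: sum_power2 lessThan_atLeast0)
  finally show ?thesis .
qed

text \<open>Monomials are ordered by their binary codes. A set containing the top generator
  \<open>g\<close> has code at least \<open>2 ^ g\<close>, above every set of smaller generators, so
  the left branch precedes the right one.\<close>

lemma trie_val_lead: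
  assumes "sorted_wrt (>) gs" "trie_ok (length gs) v" "v \<noteq> Zero"
  shows "trie_val gs v (lead gs v) = (of_int (lead_val v) :: 'a::comm_ring_1)"
    and "set_encode T < set_encode (lead gs v) \<Longrightarrow> trie_val gs v T = (0 :: 'a)"
proof -
  have "trie_val gs v (lead gs v) = (of_int (lead_val v) :: 'a) \<and>
    (\<forall>T. set_encode T < set_encode (lead gs v) \<longrightarrow> trie_val gs v T = (0 :: 'a))"
    using assms
  proof (induction gs v rule: trie_val.induct)
    case (5 g gs a b)
    have lt: "\<And>x. x \<in> set gs \<Longrightarrow> x < g" using 5 by auto
    have notin: "g \<notin> lead gs v" for v using lead_subset[of gs v] lt by auto
    have fin: "finite (lead gs v)" for v using lead_subset[of gs v] finite_subset by blast
    have a0: "trie_val gs a T = (0 :: 'a)" if "g \<in> T" for T and a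
      using trie_val_support[of gs a T, where ?'a = 'a] lt that by auto
    show ?case
    proof (cases "a = Zero")
      case True
      then have IH: "trie_val gs b (lead gs b) = (of_int (lead_val b) :: 'a)"
        "\<And>T. set_encode T < set_encode (lead gs b) \<Longrightarrow> trie_val gs b T = (0 :: 'a)"
        using 5 by auto
      have "trie_val (g # gs) (Node a b) T = (0 :: 'a)" if "set_encode T < set_encode (insert g (lead gs b))" for T
      proof (cases "g \<in> T \<and> T \<subseteq> set (g # gs)")
        case T: True
        then have "finite (T - {g})" using finite_subset[of T "set (g # gs)"] by auto
        then have "set_encode T = 2 ^ g + set_encode (T - {g})"
          using set_encode_insert[of "T - {g}" g] T by (simp add: insert_absorb)
        then have "set_encode (T - {g}) < set_encode (lead gs b)"
          using that fin notin by (simp add: set_encode_insert)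
        then show ?thesis using True T IH by (simp add: rmul_def)
      next
        case False
        then show ?thesis
          using True trie_val_support[of "g # gs" "Node a b" T, where ?'a = 'a] by (auto simp: rmul_def)
      qed
      then show ?thesis using True IH notin[of b] by (simp add: rmul_def lead_val_Node)
    next
      case False
      then have IH: "trie_val gs a (lead gs a) = (of_int (lead_val a) :: 'a)"
        "\<And>T. set_encode T < set_encode (lead gs a) \<Longrightarrow> trie_val gs a T = (0 :: 'a)"
        using 5 by auto
      have "trie_val (g # gs) (Node a b) T = (0 :: 'a)" if T: "set_encode T < set_encode (lead gs a)" for T
      proof (cases "g \<in> T \<and> T \<subseteq> set (g # gs)")
        case True
        then have "finite T" using finite_subset[of T "set (g # gs)"] by auto
        then have "2 ^ g \<le> set_encode T"
          using True by (auto simp: set_encode_def intro: member_le_sum)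
        moreover have "set_encode (lead gs a) < 2 ^ g"
          using lead_subset[of gs a] lt fin by (intro set_encode_less) auto
        ultimately show ?thesis using T by simp
      next
        case F: False
        then show ?thesis
          using T IH trie_val_support[of "g # gs" "Node a b" T, where ?'a = 'a] by (auto simp: rmul_def)
      qed
      then show ?thesis using False IH notin[of a] by (simp add: rmul_def lead_val_Node)
    qed
  qed (auto simp: escale_def emon_def)
  then show "trie_val gs v (lead gs v) = (of_int (lead_val v) :: 'a)"
    "set_encode T < set_encode (lead gs v) \<Longrightarrow> trie_val gs v T = (0 :: 'a)" by auto
qed

text \<open>The triples consist of the leading monomial, the pivot and the row.\<close>

fun tab_entries :: "nat list \<Rightarrow> tab \<Rightarrow> (nat set \<times> int \<times> trie) set" where
  "tab_entries [] (Pivot p w) = {({}, p, w)}"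
| "tab_entries (g # gs) (Fork l r) = tab_entries gs l \<union> (\<lambda>(S, e). (insert g S, e)) ` tab_entries gs r"
| "tab_entries _ _ = {}"

fun tab_ok :: "nat \<Rightarrow> tab \<Rightarrow> bool" where
  "tab_ok n Empty = True"
| "tab_ok 0 (Pivot p w) = True"
| "tab_ok (Suc n) (Fork l r) = (tab_ok n l \<and> tab_ok n r)"
| "tab_ok _ _ = False"

lemma tab_ok_Pivot: "tab_ok n (Pivot p w) \<longleftrightarrow> n = 0"
  by (cases n) auto

lemma tab_ok_Fork: "tab_ok n (Fork l r) \<longleftrightarrow> (\<exists>m. n = Suc m \<and> tab_ok m l \<and> tab_ok m r)"
  by (cases n) auto

lemma tab_entries_subset: "(S, e) \<in> tab_entries gs T \<Longrightarrow> S \<subseteq> set gs"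
  by (induction gs T arbitrary: S rule: tab_entries.induct) auto

lemma tab_entries_Empty [simp]: "tab_entries gs Empty = {}"
  by (cases gs) auto

lemma find_pivot_Hit:
  "find_pivot q T = Hit f p r \<Longrightarrow> trie_ok (length gs) q \<Longrightarrow> tab_ok (length gs) T \<Longrightarrow> f = lead_val q \<and> (lead gs q, p, r) \<in> tab_entries gs T"
proof (induction q T arbitrary: gs rule: find_pivot.induct)
  case (2 f p r)
  then show ?case by (cases gs) auto
next
  case (3 b l r)
  then show ?case by (cases gs) force+
next
  case (4 c b l r)
  then show ?case by (cases gs) force+
next
  case (5 x y b l r)
  then show ?case by (cases gs) force+
qed auto

text \<open>\<open>Miss\<close> says that the slot of the leading monomial is free, so no stored row
  is overwritten.\<close>

lemma insert_pivot_correct: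
  "find_pivot q T = Miss \<Longrightarrow> trie_ok (length gs) q \<Longrightarrow> q \<noteq> Zero \<Longrightarrow> tab_ok (length gs) T \<Longrightarrow>
   tab_ok (length gs) (insert_pivot w q T) \<and> tab_entries gs (insert_pivot w q T) = insert (lead gs q, lead_val q, w) (tab_entries gs T)"
proof (induction w q T arbitrary: gs rule: insert_pivot.induct)
  case (1 w f T)
  then show ?case by (cases T; cases gs) auto
next
  case (2 w b l r)
  then show ?case by (cases gs) auto
next
  case (3 w b)
  then show ?case by (cases gs) auto
next
  case (4 w c b l r)
  then show ?case by (cases gs) auto
next
  case (5 w c b)
  then show ?case by (cases gs) auto
next
  case (6 w x y b l r)
  then show ?case by (cases gs) auto
next
  case (7 w x y b)
  then show ?case by (cases gs) auto
qed (auto simp: trie_ok_Coef trie_ok_Node tab_ok_Pivot tab_ok_Fork)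

section \<open>Invariance of the row span\<close>

definition tab_inv :: "nat list \<Rightarrow> tab \<Rightarrow> bool" where
  "tab_inv gs T \<longleftrightarrow> tab_ok (length gs) T \<and>
    (\<forall>(S, p, w)\<in>tab_entries gs T. trie_ok (length gs) w \<and> w \<noteq> Zero \<and> lead gs w = S \<and> lead_val w = p)"

definition tab_vecs :: "nat list \<Rightarrow> tab \<Rightarrow> 'a::comm_ring_1 ext set" where
  "tab_vecs gs T = (\<lambda>(S, p, w). trie_val gs w) ` tab_entries gs T"

text \<open>The condition under which the integer steps are valid over the field. Entries are never
  removed, so imposing it on the final table covers every step.\<close>

definition pivots_nonzero :: "'a::comm_ring_1 itself \<Rightarrow> nat list \<Rightarrow> tab \<Rightarrow> bool" where
  "pivots_nonzero _ gs T \<longleftrightarrow> (\<forall>(S, p, w)\<in>tab_entries gs T. of_int p \<noteq> (0 :: 'a))"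

lemma neg_trie_Zero_iff [simp]: "neg_trie v = Zero \<longleftrightarrow> v = Zero"
  by (cases v) auto

lemma lead_neg_trie: "lead gs (neg_trie v) = lead gs v"
  by (induction gs v rule: lead.induct) auto

lemma find_pivot_neg_trie_Miss: "find_pivot (neg_trie q) T = Miss \<longleftrightarrow> find_pivot q T = Miss"
  by (induction q T rule: find_pivot.induct) auto

lemma span_insert_scale:
  assumes "(c :: 'a::field) \<noteq> 0"
  shows "ext.span (insert (escale c x) X) = ext.span (insert x X)"
proof -
  have "x = escale (inverse c) (escale c x)" using assms by (simp add: escale_simps)
  then have "x \<in> ext.span (insert (escale c x) X)"
    by (metis ext.span_base ext.span_scale insertI1)
  moreover have "escale c x \<in> ext.span (insert x X)"
    by (simp add: ext.span_base ext.span_scale)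
  ultimately show ?thesis
    unfolding ext.span_eq by (auto intro: ext.span_base)
qed

lemma span_insert_add:
  assumes "y \<in> ext.span X"
  shows "ext.span (insert (x - y) X) = ext.span (insert x X)"
proof -
  have "ext.span X \<subseteq> ext.span (insert z X)" for z by (rule ext.span_mono) auto
  then have y: "y \<in> ext.span (insert z X)" for z using assms by blast
  have "(x - y) + y \<in> ext.span (insert (x - y) X)"
    by (rule ext.span_add[OF _ y]) (simp add: ext.span_base)
  moreover have "x - y \<in> ext.span (insert x X)"
    by (rule ext.span_diff[OF _ y]) (simp add: ext.span_base)
  ultimately show ?thesis
    unfolding ext.span_eq by (auto intro: ext.span_base)
qed

text \<open>The step is reversible: \<open>c\<close> is invertible and \<open>r\<close> stays
  available in \<open>X\<close>.\<close>

lemma span_reduce_by: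
  fixes q r :: "'a::field ext"
  assumes "r \<in> X" "c \<noteq> 0"
  shows "ext.span (insert (escale c q - escale d r) X) = ext.span (insert q X)"
  using span_insert_add[of "escale d r" X "escale c q"] span_insert_scale[of c q X] assms
  by (simp add: ext.span_base ext.span_scale)

lemma reduce_by_correct:
  assumes "f \<noteq> 0" "p \<noteq> 0" "trie_ok (length gs) q" "trie_ok (length gs) r"
  shows "trie_ok (length gs) (reduce_by p f q r)"
    and "trie_val gs (reduce_by p f q r) = escale (of_int p) (trie_val gs q) - escale (of_int f) (trie_val gs r)"
  using assms by (simp_all add: reduce_by_def trie_ok_sub_mult trie_ok_scale_trie trie_val_sub_mult trie_val_scale_trie)

lemma insert_row_correct:
  assumes "find_pivot q T = Miss" "q \<noteq> Zero" "trie_ok (length gs) q" "tab_inv gs T"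
  defines "T' \<equiv> insert_row (make_pos (lead_val q) q) T"
  shows "tab_inv gs T'" "tab_entries gs T \<subseteq> tab_entries gs T'"
    "ext.span (tab_vecs gs T') = ext.span (insert (trie_val gs q) (tab_vecs gs T) :: 'a::field ext set)"
proof -
  define w where "w = make_pos (lead_val q) q"
  have w: "find_pivot w T = Miss" "w \<noteq> Zero" "trie_ok (length gs) w" "lead gs w = lead gs q"
    using assms(1-3) by (auto simp: w_def make_pos_def find_pivot_neg_trie_Miss trie_ok_neg_trie lead_neg_trie)
  have insert_pivot: "tab_ok (length gs) T'" "tab_entries gs T' = insert (lead gs w, lead_val w, w) (tab_entries gs T)"
    using insert_pivot_correct[OF w(1,3,2), of w] assms(4) by (auto simp: T'_def w_def insert_row_def tab_inv_def)
  then show "tab_inv gs T'" "tab_entries gs T \<subseteq> tab_entries gs T'"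
    using assms(4) w by (auto simp: tab_inv_def)
  have "trie_val gs w = escale (if lead_val q < 0 then - 1 else 1) (trie_val gs q :: 'a ext)"
    by (simp add: w_def make_pos_def trie_val_neg_trie escale_simps)
  then show "ext.span (tab_vecs gs T') = ext.span (insert (trie_val gs q) (tab_vecs gs T) :: 'a ext set)"
    using span_insert_scale[of "if lead_val q < 0 then - 1 else 1" "trie_val gs q :: 'a ext" "tab_vecs gs T"]
    by (simp add: tab_vecs_def insert_pivot)
qed

text \<open>Success within the step bound is a premise and is later settled by evaluation. The pivot
  used in a reduction also occurs in \<open>T'\<close>, so it is invertible once \<open>T'\<close>
  is known to have nonzero pivots.\<close>

lemma add_row_correct:
  fixes gs :: "nat list"
  defines "P \<equiv> \<lambda>q T T'. tab_inv gs T' \<and> tab_entries gs T \<subseteq> tab_entries gs T' \<and> (pivots_nonzero TYPE('a::field) gs T' \<longrightarrow>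
    ext.span (tab_vecs gs T') = ext.span (insert (trie_val gs q) (tab_vecs gs T) :: 'a ext set))"
  shows "add_row i q T = Some T' \<Longrightarrow> trie_ok (length gs) q \<Longrightarrow> tab_inv gs T \<Longrightarrow> P q T T'"
    and "add_found i q T h = Some T' \<Longrightarrow> h = find_pivot q T \<Longrightarrow> q \<noteq> Zero \<Longrightarrow> trie_ok (length gs) q \<Longrightarrow> tab_inv gs T \<Longrightarrow> P q T T'"
proof (induction i q T and i q T h arbitrary: T' and T' rule: add_row_add_found.induct)
  case (1 i T)
  have "ext.span (insert 0 X) = ext.span X" for X :: "'a ext set" by simp
  with 1 show ?case by (simp add: P_def)
next
  case (4 i q T)
  then show ?case using insert_row_correct(1,2)[of q T gs] insert_row_correct(3)[of q T gs] by (auto simp: P_def)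
next
  case (5 i q T f p r)
  have lookup: "f = lead_val q" "(lead gs q, p, r) \<in> tab_entries gs T"
    using find_pivot_Hit[of q T f p r gs] 5 by (auto simp: tab_inv_def)
  then have r: "trie_ok (length gs) r" "p = lead_val r" "r \<noteq> Zero" using 5(6) by (auto simp: tab_inv_def)
  have nz: "f \<noteq> 0" "p \<noteq> 0" using lookup r lead_val_nonzero 5 by auto
  note reduce_by = reduce_by_correct[OF nz 5(5) r(1)]
  have "P (reduce_by p f q r) T T'" using 5(2) by (intro 5(1)[OF _ reduce_by(1) 5(6)]) simp
  moreover have "ext.span (insert (trie_val gs (reduce_by p f q r)) (tab_vecs gs T)) = ext.span (insert (trie_val gs q) (tab_vecs gs T) :: 'a ext set)"
    if "tab_entries gs T \<subseteq> tab_entries gs T'" "pivots_nonzero TYPE('a) gs T'"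
  proof -
    have "of_int p \<noteq> (0 :: 'a)" using that lookup by (auto simp: pivots_nonzero_def)
    moreover have "trie_val gs r \<in> (tab_vecs gs T :: 'a ext set)"
      using lookup by (force simp: tab_vecs_def)
    ultimately show ?thesis by (simp add: reduce_by span_reduce_by)
  qed
  ultimately show ?case by (auto simp: P_def)
next
  case (6 q T f p r)
  from 6(1) show ?case by simp
qed auto

lemma pivots_nonzero_mono: "tab_entries gs T \<subseteq> tab_entries gs T' \<Longrightarrow> pivots_nonzero F gs T' \<Longrightarrow> pivots_nonzero F gs T"
  by (auto simp: pivots_nonzero_def)

lemma add_rows_None: "add_rows i qs None = None"
  by (cases qs) auto

lemma add_rows_append: "add_rows i (qs @ qs') T = add_rows i qs' (add_rows i qs T)"
  by (induction i qs T rule: add_rows.induct) (auto simp: add_rows_None)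

lemma add_rows_correct:
  assumes "add_rows i qs (Some T) = Some T'" "\<forall>q\<in>set qs. trie_ok (length gs) q" "tab_inv gs T"
  shows "tab_inv gs T' \<and> tab_entries gs T \<subseteq> tab_entries gs T' \<and> (pivots_nonzero TYPE('a::field) gs T' \<longrightarrow>
    ext.span (tab_vecs gs T') = ext.span (trie_val gs ` set qs \<union> tab_vecs gs T :: 'a ext set))"
  using assms
proof (induction qs arbitrary: T)
  case Nil
  then show ?case by simp
next
  case (Cons q qs)
  obtain T1 where T1: "add_row i q T = Some T1" "add_rows i qs (Some T1) = Some T'"
    using Cons.prems(1) by (cases "add_row i q T") (auto simp: add_rows_None)
  have 1: "tab_inv gs T1" "tab_entries gs T \<subseteq> tab_entries gs T1" "pivots_nonzero TYPE('a) gs T1 \<Longrightarrow>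
      ext.span (tab_vecs gs T1) = ext.span (insert (trie_val gs q) (tab_vecs gs T) :: 'a ext set)"
    using add_row_correct(1)[OF T1(1)] Cons.prems by auto
  have 2: "tab_inv gs T'" "tab_entries gs T1 \<subseteq> tab_entries gs T'" "pivots_nonzero TYPE('a) gs T' \<Longrightarrow>
      ext.span (tab_vecs gs T') = ext.span (trie_val gs ` set qs \<union> tab_vecs gs T1 :: 'a ext set)"
    using Cons.IH[OF T1(2)] Cons.prems 1 by auto
  have "ext.span (tab_vecs gs T') = ext.span (trie_val gs ` set (q # qs) \<union> tab_vecs gs T :: 'a ext set)"
    if nz: "pivots_nonzero TYPE('a) gs T'"
  proof -
    let ?A = "trie_val gs ` set qs :: 'a ext set"
    have eq: "ext.span (tab_vecs gs T1) = ext.span (insert (trie_val gs q) (tab_vecs gs T) :: 'a ext set)"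
      using 1(3) pivots_nonzero_mono[OF 2(2) nz] by blast
    have "ext.span (?A \<union> tab_vecs gs T1) = ext.span (?A \<union> insert (trie_val gs q) (tab_vecs gs T))"
      unfolding ext.span_Un eq ..
    then show ?thesis using 2(3)[OF nz] by simp
  qed
  then show ?case using 1 2 by auto
qed

section \<open>Independence of the stored rows and their number\<close>

text \<open>At the smallest leading monomial one vector is nonzero and all others vanish, so it is
  outside their span.\<close>

lemma independent_leading:
  fixes v :: "'i \<Rightarrow> 'a::field ext" and l :: "'i \<Rightarrow> nat"
  assumes "finite I" "inj_on l I" "\<And>i. i \<in> I \<Longrightarrow> l i = set_encode (s i)"
    and "\<And>i. i \<in> I \<Longrightarrow> v i (s i) \<noteq> 0" "\<And>i T. i \<in> I \<Longrightarrow> set_encode T < l i \<Longrightarrow> v i T = 0"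
  shows "inj_on v I \<and> ext.independent (v ` I)"
  using assms
\<comment> \<open>The ranking is negated so that the vector added last has the smallest leading
  monomial.\<close>
proof (induction I rule: finite_ranking_induct[where f = "\<lambda>i. - int (l i)"])
  case empty
  then show ?case by (simp add: ext.independent_empty)
next
  case (insert x S)
  show ?case
  proof (cases "x \<in> S")
    case True
    then show ?thesis using insert by (simp add: insert_absorb)
  next
    case False
    have "v y (s x) = 0" if "y \<in> S" for y
    proof -
      have "l x \<le> l y" using insert.hyps(2)[OF that] by simp
      moreover have "l x \<noteq> l y" using insert.prems(1) that False by (auto simp: inj_on_def)
      ultimately show ?thesis using insert.prems(2)[of x] insert.prems(4)[of y "s x"] that by simp
    qed
    then have "v ` S \<subseteq> {y. y (s x) = 0}" by auto
    moreover have "ext.subspace {y :: 'a ext. y (s x) = 0}"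
      by (rule ext.subspaceI) (auto simp: escale_def)
    ultimately have "ext.span (v ` S) \<subseteq> {y. y (s x) = 0}" by (rule ext.span_minimal)
    then have notin: "v x \<notin> ext.span (v ` S)" using insert.prems(3)[of x] by auto
    then have "v x \<notin> v ` S" using ext.span_base by blast
    moreover have "inj_on v S \<and> ext.independent (v ` S)"
      using insert.prems by (intro insert.IH) (auto intro: inj_on_subset)
    ultimately show ?thesis using notin False by (simp add: ext.independent_insert)
  qed
qed

fun plus_opt :: "nat option \<Rightarrow> nat option \<Rightarrow> nat option" where
  "plus_opt (Some a) (Some b) = Some (a + b)"
| "plus_opt _ _ = None"

text \<open>The point is that \<open>p\<close> has no prime factors besides 2 and 3; the exponent 8
  is a generous bound. Returning \<open>Some 1\<close> lets one pass both check and count the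
  pivots.\<close>

definition unit_pivot :: "int \<Rightarrow> nat option" where
  "unit_pivot p = (if p dvd 6 ^ 8 then Some 1 else None)"

fun tally :: "tab \<Rightarrow> nat option" where
  "tally Empty = Some 0"
| "tally (Pivot p w) = unit_pivot p"
| "tally (Fork l r) = plus_opt (tally l) (tally r)"

fun tally_opt :: "tab option \<Rightarrow> nat option" where
  "tally_opt None = None"
| "tally_opt (Some T) = tally T"

lemma plus_opt_Some: "plus_opt x y = Some k \<longleftrightarrow> (\<exists>a b. x = Some a \<and> y = Some b \<and> k = a + b)"
  by (cases "(x, y)" rule: plus_opt.cases) auto

text \<open>Keys from the right branch contain \<open>g\<close> and those from the left do not, so
  the keys are distinct and the counts add.\<close>

lemma tally_correct:
  assumes "tally T = Some k" "tab_ok (length gs) T" "sorted_wrt (>) gs"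
  shows "finite (tab_entries gs T) \<and> card (tab_entries gs T) = k \<and> inj_on fst (tab_entries gs T)
    \<and> (\<forall>(S, p, w)\<in>tab_entries gs T. p dvd 6 ^ 8)"
  using assms
proof (induction T arbitrary: gs k)
  case Empty
  then show ?case by simp
next
  case (Pivot p w)
  then have "gs = []" by (simp add: tab_ok_Pivot)
  then show ?case using Pivot by (auto simp: unit_pivot_def split: if_splits)
next
  case (Fork l r)
  then obtain g gs' where gs: "gs = g # gs'" by (cases gs) auto
  obtain a b where ab: "tally l = Some a" "tally r = Some b" "k = a + b"
    using Fork.prems by (auto simp: plus_opt_Some)
  have l: "finite (tab_entries gs' l) \<and> card (tab_entries gs' l) = a \<and> inj_on fst (tab_entries gs' l)
      \<and> (\<forall>(S, p, w)\<in>tab_entries gs' l. p dvd 6 ^ 8)"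
    using Fork gs ab by (intro Fork.IH(1)) auto
  have r: "finite (tab_entries gs' r) \<and> card (tab_entries gs' r) = b \<and> inj_on fst (tab_entries gs' r)
      \<and> (\<forall>(S, p, w)\<in>tab_entries gs' r. p dvd 6 ^ 8)"
    using Fork gs ab by (intro Fork.IH(2)) auto
  let ?f = "\<lambda>(S, e). (insert g S, e :: int \<times> trie)"
  have notin: "g \<notin> S" if "(S, e) \<in> tab_entries gs' t" for S e t
    using tab_entries_subset[OF that] Fork.prems(3) gs by auto
  have inj: "inj_on ?f (tab_entries gs' r)"
  proof (rule inj_onI)
    fix x y assume *: "x \<in> tab_entries gs' r" "y \<in> tab_entries gs' r" "?f x = ?f y"
    moreover obtain S e S' e' where "x = (S, e)" "y = (S', e')" by (cases x, cases y)
    ultimately show "x = y" using notin[of S e r] notin[of S' e' r] by (simp add: insert_ident)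
  qed
  have disj: "tab_entries gs' l \<inter> ?f ` tab_entries gs' r = {}"
    using notin[of _ _ l] by auto
  have "inj_on fst (tab_entries gs' l \<union> ?f ` tab_entries gs' r)"
  proof (rule inj_onI)
    fix x y assume x: "x \<in> tab_entries gs' l \<union> ?f ` tab_entries gs' r" and y: "y \<in> tab_entries gs' l \<union> ?f ` tab_entries gs' r" and eq: "fst x = fst y"
    have lr: False if "u \<in> tab_entries gs' l" "v \<in> ?f ` tab_entries gs' r" "fst u = fst v" for u v
      using that notin[of "fst u" "snd u" l] by (cases u) auto
    consider "x \<in> tab_entries gs' l" "y \<in> tab_entries gs' l" | "x \<in> ?f ` tab_entries gs' r" "y \<in> ?f ` tab_entries gs' r"
      using x y eq lr[of x y] lr[of y x] unfolding Un_iff by argo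
    then show "x = y"
    proof cases
      case 1
      then show ?thesis using l eq by (auto dest: inj_onD)
    next
      case 2
      then obtain S e S' e' where *: "(S, e) \<in> tab_entries gs' r" "(S', e') \<in> tab_entries gs' r" "x = (insert g S, e)" "y = (insert g S', e')"
        by auto
      then have "S = S'" using eq notin by (simp add: insert_ident)
      then have "e = e'" using r * inj_onD[of fst "tab_entries gs' r" "(S, e)" "(S', e')"] by auto
      with * \<open>S = S'\<close> show ?thesis by simp
    qed
  qed
  then show ?case using l r gs ab disj inj by (auto simp: card_Un_disjoint card_image)
qed

text \<open>The stored rows span the same space as the input and have distinct leading monomials
  with invertible coefficients, hence form a basis of it.\<close>

lemma rank_eq_tally:
  fixes F :: "'a::field itself"
  assumes "(2 :: 'a) \<noteq> 0" "(3 :: 'a) \<noteq> 0" "sorted_wrt (>) gs"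
    and "tally_opt (add_rows i qs (Some Empty)) = Some k" "\<forall>q\<in>set qs. trie_ok (length gs) q"
  shows "ext.dim (trie_val gs ` set qs :: 'a ext set) = k"
proof -
  obtain T where T: "add_rows i qs (Some Empty) = Some T" "tally T = Some k"
    using assms(4) by (cases "add_rows i qs (Some Empty)") auto
  have "tab_inv gs Empty" by (simp add: tab_inv_def)
  note * = add_rows_correct[OF T(1) assms(5) this, where ?'a = 'a]
  have inv: "\<And>S p w. (S, p, w) \<in> tab_entries gs T \<Longrightarrow> trie_ok (length gs) w \<and> w \<noteq> Zero \<and> lead gs w = S \<and> lead_val w = p"
    and "tab_ok (length gs) T"
    using * by (auto simp: tab_inv_def)
  note tal = tally_correct[OF T(2) this(2) assms(3)]
  have "of_int p \<noteq> (0 :: 'a)" if p: "p dvd 6 ^ 8" for p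
  proof -
    obtain c where "6 ^ 8 = p * c" using p by (rule dvdE)
    then have "of_int p * of_int c = (of_int (6 ^ 8) :: 'a)" by (metis of_int_mult)
    moreover have "of_int (6 ^ 8) = ((2 * 3) ^ 8 :: 'a)" by simp
    moreover have "\<dots> \<noteq> (0 :: 'a)" using assms(1,2) by (simp only: mult_eq_0_iff power_eq_0_iff) simp
    ultimately show ?thesis by auto
  qed
  then have nz: "\<And>S p w. (S, p, w) \<in> tab_entries gs T \<Longrightarrow> of_int p \<noteq> (0 :: 'a)"
    using tal by fast
  then have "pivots_nonzero TYPE('a) gs T" by (auto simp: pivots_nonzero_def)
  then have span: "ext.span (tab_vecs gs T) = ext.span (trie_val gs ` set qs :: 'a ext set)"
    using * by (simp add: tab_vecs_def)
  let ?v = "\<lambda>(S, p, w). trie_val gs w :: 'a ext"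
  have fin: "finite S" if "(S, e) \<in> tab_entries gs T" for S e
    using tab_entries_subset[OF that] finite_subset by blast
  have "inj_on ?v (tab_entries gs T) \<and> ext.independent (?v ` tab_entries gs T)"
  proof (rule independent_leading[where s = fst and l = "\<lambda>x. set_encode (fst x)"])
    show "inj_on (\<lambda>x. set_encode (fst x)) (tab_entries gs T)"
    proof (rule inj_onI)
      fix x y assume xy: "x \<in> tab_entries gs T" "y \<in> tab_entries gs T" "set_encode (fst x) = set_encode (fst y)"
      then have "fst x = fst y" using fin[of "fst x" "snd x"] fin[of "fst y" "snd y"]
        by (simp add: set_encode_eq)
      then show "x = y" using xy(1,2) tal by (auto dest: inj_onD)
    qed
    show "?v x (fst x) \<noteq> 0" if "x \<in> tab_entries gs T" for x
    proof -
      obtain S p w where x: "x = (S, p, w)" by (cases x)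
      then show ?thesis
        using inv[of S p w] nz[of S p w] trie_val_lead(1)[OF assms(3), of w, where ?'a = 'a] that by auto
    qed
    show "?v x U = 0" if "x \<in> tab_entries gs T" "set_encode U < set_encode (fst x)" for x U
    proof -
      obtain S p w where x: "x = (S, p, w)" by (cases x)
      then show ?thesis
        using inv[of S p w] trie_val_lead(2)[OF assms(3), of w U, where ?'a = 'a] that by auto
    qed
  qed (use tal in auto)
  then have "ext.dim (?v ` tab_entries gs T) = k"
    using tal by (simp add: ext.dim_eq_card_independent card_image)
  then show ?thesis
    using ext.span_eq_dim[OF span] by (simp add: tab_vecs_def)
qed

section \<open>Enumeration of the rows\<close>

text \<open>
  With \<open>ws\<close> the products \<open>dgen u \<cdot> m\<close> for the remaining generators \<open>u\<close> and \<open>row = d m\<close>, the recursion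
  uses \<open>d (m \<cdot> h) = d m \<cdot> h + (-1)^{deg m} dgen h \<cdot> m\<close>, the sign being recorded by \<open>s\<close>.
\<close>

fun rows :: "trie list \<Rightarrow> bool \<Rightarrow> trie \<Rightarrow> nat \<Rightarrow> trie list" where
  "rows [] s row 0 = [row]"
| "rows [] s row (Suc n) = []"
| "rows (w # ws) s row 0 = rows (map (\<lambda>w. node w Zero) ws) s (node row Zero) 0"
| "rows (w # ws) s row (Suc n) =
    rows (map (\<lambda>w. node w Zero) ws) s (node row Zero) (Suc n) @
    rows (map (node Zero) ws) (\<not> s) (node (if s then neg_trie w else w) row) n"

text \<open>The grading automorphism, \<open>(-1)^deg\<close> in each degree. For a generator
  \<open>h\<close> above all those in \<open>a\<close>, the product \<open>h a\<close> equals
  \<open>grade_inv a\<close> times \<open>h\<close>.\<close>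

fun grade_inv :: "trie \<Rightarrow> trie" where
  "grade_inv Zero = Zero"
| "grade_inv (Coef c) = Coef c"
| "grade_inv (Node a b) = Node (grade_inv a) (neg_trie (grade_inv b))"

text \<open>At index 0 the generator is the top one, \<open>h\<close>; the branch \<open>b\<close>
  disappears because \<open>h b h = 0\<close>.\<close>

fun lmul_trie :: "nat \<Rightarrow> trie \<Rightarrow> trie" where
  "lmul_trie n Zero = Zero"
| "lmul_trie n (Coef c) = Zero"
| "lmul_trie 0 (Node a b) = node Zero (grade_inv a)"
| "lmul_trie (Suc n) (Node a b) = node (lmul_trie n a) (lmul_trie n b)"

text \<open>In a trie over the generators 7, \<dots>, 0 left multiplication by the generator \<open>a\<close> is \<open>lmul_trie (7 - a)\<close>.\<close>

definition dgen_muls :: "trie \<Rightarrow> trie list" where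
  "dgen_muls m =
    [neg_trie (lmul_trie 7 (lmul_trie 5 m)), neg_trie (lmul_trie 6 (lmul_trie 4 m)),
     sub_mult 1 (lmul_trie 4 (lmul_trie 3 m)) (lmul_trie 7 (lmul_trie 1 m)), sub_mult 1 (lmul_trie 7 (lmul_trie 2 m)) (lmul_trie 6 (lmul_trie 0 m)),
     sub_mult 1 (lmul_trie 6 (lmul_trie 1 m)) (lmul_trie 5 (lmul_trie 3 m)), sub_mult 1 (lmul_trie 5 (lmul_trie 0 m)) (lmul_trie 4 (lmul_trie 2 m))]"

text \<open>Generators 0 to 7 are cocycles, so \<open>m\<close> is extended by them with row zero.
  Once all are decided, \<open>dgen_muls m\<close> is computed once and shared by all monomials with
  this lower part.\<close>

fun all_rows :: "nat \<Rightarrow> bool \<Rightarrow> trie \<Rightarrow> nat \<Rightarrow> trie list" where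
  "all_rows 0 s m n = rows (dgen_muls m) s Zero n"
| "all_rows (Suc k) s m 0 = all_rows k s (Node m Zero) 0"
| "all_rows (Suc k) s m (Suc n) = all_rows k s (Node m Zero) (Suc n) @ all_rows k (\<not> s) (Node Zero m) n"

section \<open>Correctness of the enumeration\<close>

lemma grade_inv_Zero_iff [simp]: "grade_inv v = Zero \<longleftrightarrow> v = Zero"
  by (cases v) auto

lemma trie_ok_grade_inv: "trie_ok n v \<Longrightarrow> trie_ok n (grade_inv v)"
  by (induction n v rule: trie_ok.induct) (auto simp: trie_ok_neg_trie)

lemma trie_val_grade_inv: "trie_val gs (grade_inv v) T = (- 1) ^ card T * (trie_val gs v T :: 'a::comm_ring_1)"
proof (induction gs v arbitrary: T rule: trie_val.induct)
  case (5 g gs a b)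
  have "rmul g (trie_val gs (neg_trie (grade_inv b))) T = (- 1) ^ card T * (rmul g (trie_val gs b) T :: 'a)"
  proof (cases "g \<in> T \<and> finite T")
    case True
    then have *: "card T = Suc (card (T - {g}))" by (intro card.remove) auto
    show ?thesis unfolding * using 5(2)[of "T - {g}"] True by (simp add: rmul_def trie_val_neg_trie)
  next
    case False
    then have "g \<notin> T \<or> infinite (T - {g})" by simp
    moreover have "trie_val gs v U = (0 :: 'a)" if "infinite U" for v U
      using trie_val_support[of gs v U, where ?'a = 'a] that finite_subset by blast
    ultimately show ?thesis by (auto simp: rmul_def)
  qed
  then show ?case using 5 by (simp add: algebra_simps)
qed (auto simp: escale_def emon_def)

lemma lmul_top:
  assumes "\<And>x. x \<in> set gs \<Longrightarrow> x < g"
  shows "lmul g (trie_val gs a) = rmul g (trie_val gs (grade_inv a))"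
proof
  fix T
  have "sign_below g T * trie_val gs a (T - {g}) = (- 1) ^ card (T - {g}) * (trie_val gs a (T - {g}) :: 'a)" if "g \<in> T"
  proof (cases "trie_val gs a (T - {g}) = (0 :: 'a)")
    case False
    then have "T - {g} \<subseteq> set gs" using trie_val_support by blast
    then have "{x \<in> T. x < g} = T - {g}" using assms by auto
    then show ?thesis by (simp add: sign_below_def)
  qed simp
  then show "lmul g (trie_val gs a) T = (rmul g (trie_val gs (grade_inv a)) T :: 'a)"
    by (simp add: lmul_def rmul_def trie_val_grade_inv)
qed

lemma lmul_rmul_same: "lmul g (rmul g x) = 0"
  by (auto simp: lmul_def rmul_def fun_eq_iff)

lemma lmul_trie_correct:
  assumes "sorted_wrt (>) gs" "j < length gs" "trie_ok (length gs) v"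
  shows "trie_ok (length gs) (lmul_trie j v)" "trie_val gs (lmul_trie j v) = (lmul (gs ! j) (trie_val gs v) :: 'a::comm_ring_1 ext)"
proof -
  have "trie_ok (length gs) (lmul_trie j v) \<and> (\<forall>T. trie_val gs (lmul_trie j v) T = (lmul (gs ! j) (trie_val gs v) T :: 'a))"
    using assms
  proof (induction j v arbitrary: gs rule: lmul_trie.induct)
    case (3 a b)
    then obtain g gs' where gs: "gs = g # gs'" by (cases gs) auto
    have "lmul g (trie_val (g # gs') (Node a b)) = (rmul g (trie_val gs' (grade_inv a)) :: 'a ext)"
      using lmul_top[of gs' g a] 3 gs by (simp add: lmul_add lmul_rmul_same)
    then have "trie_val gs (lmul_trie 0 (Node a b)) = (lmul (gs ! 0) (trie_val gs (Node a b)) :: 'a ext)"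
      using gs by (simp add: trie_val_node)
    note fun_cong[OF this]
    moreover have "trie_ok (length gs) (lmul_trie 0 (Node a b))" using 3 gs by (simp add: trie_ok_node trie_ok_grade_inv)
    ultimately show ?case by blast
  next
    case (4 n a b)
    then obtain g gs' where gs: "gs = g # gs'" by (cases gs) auto
    have lt: "gs' ! n < g" using 4 gs by auto
    have IH: "trie_ok (length gs') (lmul_trie n a)" "trie_val gs' (lmul_trie n a) = (lmul (gs' ! n) (trie_val gs' a) :: 'a ext)"
      "trie_ok (length gs') (lmul_trie n b)" "trie_val gs' (lmul_trie n b) = (lmul (gs' ! n) (trie_val gs' b) :: 'a ext)"
      using 4 gs by (auto simp: fun_eq_iff)
    have "trie_val gs (lmul_trie (Suc n) (Node a b)) = (lmul (gs ! Suc n) (trie_val gs (Node a b)) :: 'a ext)"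
      using gs by (simp add: trie_val_node IH lmul_add lmul_rmul[OF lt])
    note fun_cong[OF this]
    moreover have "trie_ok (length gs) (lmul_trie (Suc n) (Node a b))" using gs IH by (simp add: trie_ok_node)
    ultimately show ?case by blast
  qed (auto simp: lmul_zero trie_ok_Coef)
  then show "trie_ok (length gs) (lmul_trie j v)" "trie_val gs (lmul_trie j v) = (lmul (gs ! j) (trie_val gs v) :: 'a ext)" by auto
qed

abbreviation "ups \<equiv> [8, 9, 12, 13, 14, 15 :: nat]"

text \<open>\<open>u\<close> is the last factor, so contracting it gives the sign
  \<open>(- 1) ^ card M\<close>, while contraction with a smaller generator commutes with appending
  \<open>u\<close>.\<close>

lemma diff_on_emon_insert:
  assumes "finite K" "u \<in> K" "8 \<le> u" "finite M" "\<And>x. x \<in> M \<Longrightarrow> x < u"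
  shows "diff_on K (emon (insert u M)) = escale ((- 1) ^ card M) (dgen_mul u (emon M)) + rmul u (diff_on K (emon M))"
proof -
  have sum: "rmul u (\<Sum>k\<in>A. f k) = (\<Sum>k\<in>A. rmul u (f k))" for A and f :: "nat \<Rightarrow> 'a ext"
    by (rule additive_sum[of "rmul u"]) (simp_all add: op_linear)
  have u: "u \<notin> M" using assms(5) by blast
  have "{x \<in> insert u M. x < u} = M" using assms(5) by auto
  then have cu: "contr u (emon (insert u M)) = escale ((- 1) ^ card M) (emon M :: 'a ext)"
    using u by (simp add: contr_emon sign_below_def)
  have ck: "contr k (emon (insert u M)) = rmul u (contr k (emon M) :: 'a ext)" if "k \<noteq> u" for k
  proof (cases "k < u")
    case True
    then show ?thesis using u by (simp add: contr_rmul flip: rmul_emon)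
  next
    case False
    \<comment> \<open>A larger generator does not occur, so both sides are zero.\<close>
    then have "k \<notin> insert u M" using that assms(5) by auto
    then show ?thesis by (simp add: contr_emon op_linear)
  qed
  have "diff_on K (emon (insert u M)) = dgen_mul u (contr u (emon (insert u M))) + (\<Sum>k\<in>K - {u}. dgen_mul k (contr k (emon (insert u M) :: 'a ext)))"
    unfolding diff_on_def using assms by (intro sum.remove)
  also have "(\<Sum>k\<in>K - {u}. dgen_mul k (contr k (emon (insert u M) :: 'a ext))) = (\<Sum>k\<in>K - {u}. rmul u (dgen_mul k (contr k (emon M))))"
    using assms by (intro sum.cong) (auto simp: ck dgen_mul_rmul)
  also have "\<dots> = rmul u (diff_on K (emon M))"
  proof -
    have "diff_on K (emon M) = dgen_mul u (contr u (emon M)) + (\<Sum>k\<in>K - {u}. dgen_mul k (contr k (emon M :: 'a ext)))"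
      unfolding diff_on_def using assms by (intro sum.remove)
    also have "dgen_mul u (contr u (emon M)) = (0 :: 'a ext)" using u by (simp add: contr_emon dgen_mul_zero)
    finally show ?thesis by (simp add: sum)
  qed
  finally show ?thesis by (simp add: cu dgen_mul_scale fun_eq_iff)
qed

lemma subsets_insert_Suc:
  assumes "u \<notin> A" "finite A"
  shows "{M \<union> X |X. X \<subseteq> insert u A \<and> card X = Suc n} =
    {M \<union> X |X. X \<subseteq> A \<and> card X = Suc n} \<union> {insert u M \<union> X |X. X \<subseteq> A \<and> card X = n}" (is "?L = ?R1 \<union> ?R2")
proof (intro equalityI subsetI)
  fix Y assume "Y \<in> ?L"
  then obtain X where X: "Y = M \<union> X" "X \<subseteq> insert u A" "card X = Suc n" by blast
  show "Y \<in> ?R1 \<union> ?R2"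
  proof (cases "u \<in> X")
    case True
    have "finite X" using X(2) assms(2) finite_subset by blast
    then have "card (X - {u}) = n" "X - {u} \<subseteq> A" "Y = insert u M \<union> (X - {u})"
      using True X by auto
    then show ?thesis by blast
  next
    case False
    then show ?thesis using X by blast
  qed
next
  fix Y assume "Y \<in> ?R1 \<union> ?R2"
  then show "Y \<in> ?L"
  proof
    assume "Y \<in> ?R1" then show ?thesis by blast
  next
    assume "Y \<in> ?R2"
    then obtain X where X: "Y = insert u M \<union> X" "X \<subseteq> A" "card X = n" by blast
    then have "finite X" "u \<notin> X" using assms finite_subset by auto
    then have "card (insert u X) = Suc n" using X by simp
    moreover have "Y = M \<union> insert u X" "insert u X \<subseteq> insert u A" using X by auto
    ultimately show ?thesis by blast
  qed
qed

lemma subsets_insert_0: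
  assumes "finite A"
  shows "{M \<union> X |X. X \<subseteq> insert u A \<and> card X = 0} = {M \<union> X |X. X \<subseteq> A \<and> card X = 0}"
proof -
  have "X \<subseteq> B \<and> card X = 0 \<longleftrightarrow> X = {}" if "finite B" for X B :: "'a set"
    using that finite_subset by fastforce
  then show ?thesis using assms by simp
qed

text \<open>Invariant of \<open>rows\<close>: \<open>gs\<close> are the generators already decided,
  \<open>us\<close> those still open, \<open>M\<close> the monomial chosen so far and
  \<open>s\<close> its parity.\<close>

definition row_state ::
  "'a::comm_ring_1 itself \<Rightarrow> nat set \<Rightarrow> nat list \<Rightarrow> nat list \<Rightarrow> nat set \<Rightarrow> bool \<Rightarrow> trie list \<Rightarrow> trie \<Rightarrow> bool" where
  "row_state _ U us gs M s ws row \<longleftrightarrow>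
    finite U \<and> set us \<subseteq> U \<and> sorted_wrt (<) us \<and> (\<forall>u\<in>set us. 8 \<le> u \<and> (\<forall>g\<in>set gs. g < u)) \<and>
    M \<subseteq> set gs \<and> (s \<longleftrightarrow> odd (card M)) \<and>
    list_all2 (\<lambda>w u. trie_ok (length gs) w \<and> trie_val gs w = (dgen_mul u (emon M) :: 'a ext)) ws us \<and>
    trie_ok (length gs) row \<and> trie_val gs row = (diff_on U (emon M) :: 'a ext)"

lemma row_state_skip:
  assumes "row_state (F :: 'a::comm_ring_1 itself) U (u # us) gs M s (w # ws) row"
  shows "row_state F U us (u # gs) M s (map (\<lambda>w. node w Zero) ws) (node row Zero)"
proof -
  have trie_val: "trie_val (u # gs) (node v Zero) = (trie_val gs v :: 'a ext)" for v
    by (simp add: trie_val_node rmul_zero)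
  have "list_all2 (\<lambda>w v. trie_ok (length gs) w \<and> trie_val gs w = (dgen_mul v (emon M) :: 'a ext)) ws us"
    using assms by (simp add: row_state_def)
  then have "list_all2 (\<lambda>w v. trie_ok (length (u # gs)) w \<and> trie_val (u # gs) w = (dgen_mul v (emon M) :: 'a ext))
      (map (\<lambda>w. node w Zero) ws) us"
    unfolding list_all2_map1 by (rule list_all2_mono) (simp add: trie_val trie_ok_node)
  then show ?thesis
    using assms unfolding row_state_def trie_val by (auto simp: trie_ok_node)
qed

lemma row_state_take:
  assumes "row_state (F :: 'a::comm_ring_1 itself) U (u # us) gs M s (w # ws) row"
  shows "row_state F U us (u # gs) (insert u M) (\<not> s) (map (node Zero) ws) (node (if s then neg_trie w else w) row)"
proof -
  have "\<And>x. x \<in> M \<Longrightarrow> x < u" using assms by (auto simp: row_state_def)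
  moreover have "finite M" using assms finite_subset[of M "set gs"] by (simp add: row_state_def)
  ultimately have M: "u \<notin> M" "finite M" "\<And>x. x \<in> M \<Longrightarrow> x < u" by auto
  have u: "8 \<le> u" "u \<in> U" "finite U" using assms by (simp_all add: row_state_def)
  have w: "trie_ok (length gs) w" "trie_val gs w = (dgen_mul u (emon M) :: 'a ext)"
    and row: "trie_ok (length gs) row" "trie_val gs row = (diff_on U (emon M) :: 'a ext)" and s: "s \<longleftrightarrow> odd (card M)"
    using assms by (simp_all add: row_state_def)
  have trie_val: "trie_val (u # gs) (node Zero v) = (rmul u (trie_val gs v) :: 'a ext)" for v
    by (simp add: trie_val_node)
  have dgen_mul: "rmul u (dgen_mul v (emon M)) = (dgen_mul v (emon (insert u M)) :: 'a ext)" for v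
    using u(1) M(1) by (simp add: dgen_mul_rmul flip: rmul_emon)
  have "list_all2 (\<lambda>w v. trie_ok (length gs) w \<and> trie_val gs w = (dgen_mul v (emon M) :: 'a ext)) ws us"
    using assms by (simp add: row_state_def)
  then have "list_all2 (\<lambda>w v. trie_ok (length (u # gs)) w \<and> trie_val (u # gs) w = (dgen_mul v (emon (insert u M)) :: 'a ext))
      (map (node Zero) ws) us"
    unfolding list_all2_map1 by (rule list_all2_mono) (simp add: trie_val trie_ok_node dgen_mul)
  moreover have "trie_val (u # gs) (node (if s then neg_trie w else w) row) = (diff_on U (emon (insert u M)) :: 'a ext)"
    using s w(2) row(2) by (simp add: trie_val_node trie_val_neg_trie diff_on_emon_insert[OF u(3,2,1) M(2,3)] escale_simps)
  moreover have "trie_ok (length (u # gs)) (node (if s then neg_trie w else w) row)"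
    using w(1) row(1) by (simp add: trie_ok_node trie_ok_neg_trie)
  moreover have "(\<not> s) \<longleftrightarrow> odd (card (insert u M))" using s M by simp
  ultimately show ?thesis
    using assms unfolding row_state_def by auto
qed

lemma rows_correct:
  assumes "row_state TYPE('a::comm_ring_1) U us gs M s ws row"
  shows "(\<forall>r\<in>set (rows ws s row n). trie_ok (length gs + length us) r) \<and>
    trie_val (rev us @ gs) ` set (rows ws s row n) =
      (\<lambda>Y. diff_on U (emon Y) :: 'a ext) ` {M \<union> X |X. X \<subseteq> set us \<and> card X = n}"
  using assms
proof (induction ws s row n arbitrary: us gs M rule: rows.induct)
  case (1 s row)
  then show ?case by (simp add: row_state_def)
next
  case (2 s row n)
  then show ?case by (simp add: row_state_def)
next
  case (3 w ws s row)
  then obtain u us' where us: "us = u # us'" by (cases us) (auto simp: row_state_def)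
  show ?case
    using 3(1)[OF row_state_skip[OF 3(2)[unfolded us]]] us by (simp add: subsets_insert_0)
next
  case (4 w ws s row n)
  then obtain u us' where us: "us = u # us'" by (cases us) (auto simp: row_state_def)
  note A = 4(1)[OF row_state_skip[OF 4(3)[unfolded us]]]
  note B = 4(2)[OF row_state_take[OF 4(3)[unfolded us]]]
  have "u \<notin> set us'" using 4(3) us by (auto simp: row_state_def)
  then have sets: "{M \<union> X |X. X \<subseteq> set us \<and> card X = Suc n} =
      {M \<union> X |X. X \<subseteq> set us' \<and> card X = Suc n} \<union> {insert u M \<union> X |X. X \<subseteq> set us' \<and> card X = n}"
    using us by (simp add: subsets_insert_Suc)
  have app: "rev us @ gs = rev us' @ (u # gs)" "length gs + length us = length (u # gs) + length us'"
    using us by simp_all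
  show ?case
  proof
    show "\<forall>r\<in>set (rows (w # ws) s row (Suc n)). trie_ok (length gs + length us) r"
      unfolding app rows.simps set_append ball_Un using A[THEN conjunct1] B[THEN conjunct1] by (rule conjI)
    show "trie_val (rev us @ gs) ` set (rows (w # ws) s row (Suc n)) =
      (\<lambda>Y. diff_on U (emon Y) :: 'a ext) ` {M \<union> X |X. X \<subseteq> set us \<and> card X = Suc n}"
      unfolding sets app rows.simps set_append image_Un A[THEN conjunct2] B[THEN conjunct2] ..
  qed
qed

text \<open>\<open>k\<close> counts the lower generators still open, so the next one to decide is
  \<open>8 - k\<close>, written \<open>8 - Suc k\<close> in the recursive cases.\<close>

lemma all_rows_correct:
  assumes "M \<subseteq> {..<8 - k}" "k \<le> 8" "s \<longleftrightarrow> odd (card M)" "m \<noteq> Zero" "trie_ok (8 - k) m"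
    "trie_val (rev [0..<8 - k]) m = (emon M :: 'a::comm_ring_1 ext)"
  defines "gs \<equiv> rev ups @ rev [0..<8]"
  shows "(\<forall>r\<in>set (all_rows k s m n). trie_ok 14 r) \<and>
    trie_val gs ` set (all_rows k s m n) = (\<lambda>Y. diff_on (set ups) (emon Y) :: 'a ext) ` {M \<union> X |X. X \<subseteq> {8 - k..<8} \<union> set ups \<and> card X = n}"
  using assms(1-6)
proof (induction k s m n arbitrary: M rule: all_rows.induct)
  case (1 s m n)
  define ls :: "nat list" where "ls = rev [0..<8]"
  have ls: "sorted_wrt (>) ls" "length ls = 8" "set ls = {..<8}"
    by (simp_all add: ls_def sorted_wrt_rev lessThan_atLeast0)
  have m: "trie_ok 8 m" "trie_val ls m = (emon M :: 'a ext)" using 1(5,6) by (simp_all only: ls_def diff_zero)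
  have nth: "ls ! j = 7 - j" if "j < 8" for j using that by (simp add: ls_def rev_nth)
  have e: "trie_ok 8 (lmul_trie j v)" "trie_val ls (lmul_trie j v) = (lmul (7 - j) (trie_val ls v) :: 'a ext)" if "j < 8" "trie_ok 8 v" for j v
    using lmul_trie_correct(1)[OF ls(1), of j v] lmul_trie_correct(2)[OF ls(1), of j v, where ?'a = 'a] that
    by (simp_all add: nth ls(2))
  have e2: "trie_ok 8 (lmul_trie i (lmul_trie j m))" "trie_val ls (lmul_trie i (lmul_trie j m)) = (lmul (7 - i) (lmul (7 - j) (emon M)) :: 'a ext)"
    if "i < 8" "j < 8" for i j
    using e that m by simp_all
  have sub: "trie_ok 8 (sub_mult 1 v w)" "trie_val ls (sub_mult 1 v w) = (trie_val ls v - trie_val ls w :: 'a ext)" if "trie_ok 8 v" "trie_ok 8 w" for v w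
    using that trie_val_sub_mult[of ls v w 1, where ?'a = 'a] by (simp_all add: trie_ok_sub_mult ls(2) escale_simps)
  \<comment> \<open>\<open>M\<close> lies below 8, which justifies the initial row
    \<open>Zero\<close>.\<close>
  have "diff_on (set ups) (emon M) = (0 :: 'a ext)"
  proof -
    have "contr k (emon M) = (0 :: 'a ext)" if "k \<in> set ups" for k
      using that 1 by (auto simp: contr_emon)
    then show ?thesis unfolding diff_on_def by (intro sum.neutral) (simp add: dgen_mul_zero)
  qed
  moreover have "list_all2 (\<lambda>w u. trie_ok (length ls) w \<and> trie_val ls w = (dgen_mul u (emon M) :: 'a ext)) (dgen_muls m) ups"
    by (simp add: dgen_muls_def trie_ok_neg_trie trie_val_neg_trie sub e2 dgen_mul_def ls(2))
  ultimately have rows: "(\<forall>r\<in>set (rows (dgen_muls m) s Zero n). trie_ok (length ls + length ups) r) \<and>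
    trie_val (rev ups @ ls) ` set (rows (dgen_muls m) s Zero n) = (\<lambda>Y. diff_on (set ups) (emon Y) :: 'a ext) ` {M \<union> X |X. X \<subseteq> set ups \<and> card X = n}"
    using 1(1,3) ls by (intro rows_correct) (auto simp: row_state_def)
  have 0: "{8 - 0..<8} \<union> set ups = set ups" by simp
  have 14: "length ls + length ups = 14" by (simp add: ls(2))
  show ?case using rows unfolding gs_def ls_def[symmetric] all_rows.simps 0 14 .
next
  case (2 k s m)
  have k: "8 - k = Suc (8 - Suc k)" "{8 - Suc k..<8} = insert (8 - Suc k) {8 - k..<8}" "k \<le> 8"
    using 2(3) by auto
  have M: "M \<subseteq> {..<8 - k}" using 2(2) unfolding k(1) by auto
  have v: "trie_ok (8 - k) (Node m Zero)" using 2(5,6) unfolding k(1) by simp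
  have "trie_val (rev [0..<8 - k]) (Node m Zero) = (emon M :: 'a ext)"
    unfolding k(1) using 2(7) by (simp add: op_linear)
  note 2(1)[OF M k(3) 2(4) trie.distinct(3)[symmetric] v this]
  moreover have "{M \<union> X |X. X \<subseteq> {8 - Suc k..<8} \<union> set ups \<and> card X = 0} =
      {M \<union> X |X. X \<subseteq> {8 - k..<8} \<union> set ups \<and> card X = 0}"
    unfolding k(2) Un_insert_left by (rule subsets_insert_0) simp
  ultimately show ?case unfolding all_rows.simps by simp
next
  case (3 k s m n)
  let ?g = "8 - Suc k"
  have k: "8 - k = Suc ?g" "{8 - Suc k..<8} = insert ?g {8 - k..<8}" "k \<le> 8"
    using 3(4) by auto
  have g: "?g \<notin> M" "finite M" using 3(3) by (auto intro: finite_subset)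
  have M: "M \<subseteq> {..<8 - k}" "insert ?g M \<subseteq> {..<8 - k}" using 3(3) unfolding k(1) by auto
  have v: "trie_ok (8 - k) (Node m Zero)" "trie_ok (8 - k) (Node Zero m)" using 3(6,7) unfolding k(1) by simp_all
  have s: "(\<not> s) \<longleftrightarrow> odd (card (insert ?g M))" using 3(5) g by simp
  have eA: "trie_val (rev [0..<8 - k]) (Node m Zero) = (emon M :: 'a ext)"
    and eB: "trie_val (rev [0..<8 - k]) (Node Zero m) = (emon (insert ?g M) :: 'a ext)"
    unfolding k(1) using 3(8) g by (simp_all add: op_linear rmul_emon)
  note A = 3(1)[OF M(1) k(3) 3(5) trie.distinct(3)[symmetric] v(1) eA]
  note B = 3(2)[OF M(2) k(3) s trie.distinct(3)[symmetric] v(2) eB]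
  have gens_step: "{8 - Suc k..<8} \<union> set ups = insert ?g ({8 - k..<8} \<union> set ups)"
    unfolding k(2) by (rule Un_insert_left)
  have sets: "{M \<union> X |X. X \<subseteq> {8 - Suc k..<8} \<union> set ups \<and> card X = Suc n} =
      {M \<union> X |X. X \<subseteq> {8 - k..<8} \<union> set ups \<and> card X = Suc n} \<union>
      {insert ?g M \<union> X |X. X \<subseteq> {8 - k..<8} \<union> set ups \<and> card X = n}"
    unfolding gens_step using 3(4) by (intro subsets_insert_Suc) (auto simp: less_diff_conv2)
  show ?case
  proof
    show "\<forall>r\<in>set (all_rows (Suc k) s m (Suc n)). trie_ok 14 r"
      unfolding all_rows.simps set_append ball_Un using A[THEN conjunct1] B[THEN conjunct1] by (rule conjI)
    show "trie_val gs ` set (all_rows (Suc k) s m (Suc n)) =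
      (\<lambda>Y. diff_on (set ups) (emon Y) :: 'a ext) ` {M \<union> X |X. X \<subseteq> {8 - Suc k..<8} \<union> set ups \<and> card X = Suc n}"
      unfolding sets all_rows.simps set_append image_Un A[THEN conjunct2] B[THEN conjunct2] ..
  qed
qed

lemma subspace_diff_on_image: "ext.subspace (diff_on K ` (forms G n :: 'a::field ext set))"
proof (rule ext.subspaceI)
  show "0 \<in> diff_on K ` (forms G n :: 'a ext set)"
    using forms_zero diff_on_zero by (metis image_eqI)
  show "x + y \<in> diff_on K ` forms G n" if "x \<in> diff_on K ` forms G n" "y \<in> diff_on K ` forms G n" for x y :: "'a ext"
    using that by (auto intro!: forms_add simp flip: diff_on_add)
  show "escale c x \<in> diff_on K ` forms G n" if "x \<in> diff_on K ` forms G n" for c and x :: "'a ext"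
    using that by (auto intro!: forms_scale simp flip: diff_on_scale)
qed

text \<open>The enumerated rows are the images of the monomials and span the image.
  \<open>Coef 1\<close> is the empty monomial, before any generator is decided.\<close>

lemma dim_diff_on_forms:
  assumes "(2 :: 'a::field) \<noteq> 0" "(3 :: 'a) \<noteq> 0"
    and "tally_opt (add_rows i (all_rows 8 False (Coef 1) n) (Some Empty)) = Some k"
  shows "ext.dim (diff_on (set ups) ` (forms ({..<8} \<union> set ups) n :: 'a ext set)) = k"
proof -
  let ?G = "{..<8} \<union> set ups"
  define gs where "gs = rev ups @ rev [0..<8]"
  have "sorted_wrt (>) gs" by (simp add: gs_def sorted_wrt_append sorted_wrt_rev)
  have len: "length gs = 14" by (simp add: gs_def)
  have rows: "\<forall>r\<in>set (all_rows 8 False (Coef 1) n). trie_ok 14 r"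
    "trie_val gs ` set (all_rows 8 False (Coef 1) n) = (\<lambda>Y. diff_on (set ups) (emon Y) :: 'a ext) ` {X. X \<subseteq> ?G \<and> card X = n}"
    using all_rows_correct[of "{}" 8 False "Coef 1" n, where ?'a = 'a]
    by (auto simp: gs_def escale_simps lessThan_atLeast0)
  have dim: "ext.dim (trie_val gs ` set (all_rows 8 False (Coef 1) n) :: 'a ext set) = k"
    using assms rows(1) \<open>sorted_wrt (>) gs\<close> len by (intro rank_eq_tally) auto
  have "ext.span ((\<lambda>Y. diff_on (set ups) (emon Y) :: 'a ext) ` {X. X \<subseteq> ?G \<and> card X = n})
      = diff_on (set ups) ` forms ?G n"
  proof (rule ext.span_subspace)
    show "(\<lambda>Y. diff_on (set ups) (emon Y) :: 'a ext) ` {X. X \<subseteq> ?G \<and> card X = n} \<subseteq> diff_on (set ups) ` forms ?G n"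
      by (auto simp: forms_def emon_def)
    show "ext.subspace (diff_on (set ups) ` (forms ?G n :: 'a ext set))"
      by (rule subspace_diff_on_image)
    show "diff_on (set ups) ` forms ?G n \<subseteq> ext.span ((\<lambda>Y. diff_on (set ups) (emon Y) :: 'a ext) ` {X. X \<subseteq> ?G \<and> card X = n})"
    proof clarify
      fix x :: "'a ext" assume x: "x \<in> forms ?G n"
      let ?P = "{X. X \<subseteq> ?G \<and> card X = n}"
      have "finite ?P" by simp
      then have "x = (\<Sum>S\<in>?P. escale (x S) (emon S))"
        using x by (intro sum_emon) (auto simp: forms_def)
      then have "diff_on (set ups) x = diff_on (set ups) (\<Sum>S\<in>?P. escale (x S) (emon S))" by simp
      also have "\<dots> = (\<Sum>S\<in>?P. escale (x S) (diff_on (set ups) (emon S)))"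
        unfolding diff_on_sum diff_on_scale ..
      also have "\<dots> \<in> ext.span ((\<lambda>Y. diff_on (set ups) (emon Y)) ` ?P)"
        by (intro ext.span_sum ext.span_scale ext.span_base) auto
      finally show "diff_on (set ups) x \<in> ext.span ((\<lambda>Y. diff_on (set ups) (emon Y)) ` ?P)" .
    qed
  qed
  then show ?thesis using dim rows(2) by (metis ext.dim_span)
qed

section \<open>Evaluation\<close>

lemma coef_eval: "coef 0 = Zero" "coef 1 = Coef 1" "coef (numeral n) = Coef (numeral n)"
  "coef (- 1) = Coef (- 1)" "coef (- numeral n) = Coef (- numeral n)"
  by (simp_all add: coef_def)

lemma make_pos_eval: "make_pos 1 q = q" "make_pos (numeral n) q = q" "make_pos (- 1) q = neg_trie q" "make_pos (- numeral n) q = neg_trie q"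
  by (simp_all add: make_pos_def)

lemma scale_trie_1: "scale_trie 1 q = q"
  by (induction q) auto

lemma reduce_by_eval: "reduce_by 1 f q r = sub_mult f q r" "reduce_by (numeral n) f q r = sub_mult f (scale_trie (numeral n) q) r"
  by (simp_all add: reduce_by_def scale_trie_1)

lemma unit_pivot_eval:
  "unit_pivot 1 = Some 1" "unit_pivot 2 = Some 1" "unit_pivot 3 = Some 1" "unit_pivot 4 = Some 1" "unit_pivot 6 = Some 1"
  "unit_pivot 8 = Some 1" "unit_pivot 9 = Some 1" "unit_pivot 12 = Some 1" "unit_pivot 16 = Some 1" "unit_pivot 18 = Some 1"
  "unit_pivot 24 = Some 1" "unit_pivot 32 = Some 1" "unit_pivot 36 = Some 1" "unit_pivot 48 = Some 1" "unit_pivot 64 = Some 1"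
  by (simp_all add: unit_pivot_def)

text \<open>With \<open>right_nodes\<close> and \<open>neg_trie_if\<close> a first-order replacement
  of the \<open>map\<close> and \<open>if\<close> terms in \<open>rows\<close>.\<close>

fun left_nodes :: "trie list \<Rightarrow> trie list" where
  "left_nodes [] = []"
| "left_nodes (w # ws) = node w Zero # left_nodes ws"

fun right_nodes :: "trie list \<Rightarrow> trie list" where
  "right_nodes [] = []"
| "right_nodes (w # ws) = node Zero w # right_nodes ws"

fun neg_trie_if :: "bool \<Rightarrow> trie \<Rightarrow> trie" where
  "neg_trie_if True w = neg_trie w"
| "neg_trie_if False w = w"

lemma map_node: "map (\<lambda>w. node w Zero) ws = left_nodes ws" "map (node Zero) ws = right_nodes ws"
  by (induction ws) auto

lemma neg_trie_if: "(if s then neg_trie w else w) = neg_trie_if s w"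
  by (cases s) auto

text \<open>Elimination takes the rows of one lower monomial at a time, so the full list of rows is
  never formed.\<close>

lemma add_all_rows:
  "add_rows i (all_rows 0 s m n) T = add_rows i (rows (dgen_muls m) s Zero n) T"
  "add_rows i (all_rows (Suc k) s m 0) T = add_rows i (all_rows k s (Node m Zero) 0) T"
  "add_rows i (all_rows (Suc k) s m (Suc n)) T =
    add_rows i (all_rows k (\<not> s) (Node Zero m) n) (add_rows i (all_rows k s (Node m Zero) (Suc n)) T)"
  by (simp_all add: add_rows_append)

text \<open>40 bounds the reductions of a single row; too small a bound would give
  \<open>None\<close>, never a wrong rank.\<close>

definition computed_rank :: "nat \<Rightarrow> nat option" where
  "computed_rank n = tally_opt (add_rows 40 (all_rows 8 False (Coef 1) n) (Some Empty))"

text \<open>The right-hand sides avoid conditionals and case distinctions: a congruence rule would make the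
  simplifier traverse the pivot table again after every step.\<close>

lemmas unary_numerals = eval_nat_numeral BitM.simps One_nat_def

text \<open>Natural numbers become unary so that they match the recursion patterns; trie
  coefficients stay binary integer numerals.\<close>

lemmas elimination_eval =
  computed_rank_def[unfolded unary_numerals] dgen_muls_def[unfolded unary_numerals]
  node.simps coef_eval scale_trie.simps sub_mult.simps neg_trie.simps find_pivot.simps insert_pivot.simps lead_val.simps make_pos_eval reduce_by_eval
  add_row.simps add_found.simps insert_row_def add_rows.simps rows.simps[unfolded map_node neg_trie_if] add_all_rows
  left_nodes.simps right_nodes.simps neg_trie_if.simps grade_inv.simps lmul_trie.simps
  tally_opt.simps tally.simps unit_pivot_eval plus_opt.simps
  append.simps not_True_eq_False not_False_eq_True
  arith_simps Num.inc.simps numeral_One more_arith_simps arith_special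

section \<open>Ranks of the reduced differential in degrees 0 to 14\<close>

lemma computed_rank_0: "computed_rank 0 = Some 0"
  by (simp only: elimination_eval)

lemma computed_rank_1: "computed_rank (Suc 0) = Some 6"
  by (simp only: elimination_eval)

lemma computed_rank_2: "computed_rank (Suc (Suc 0)) = Some 54"
  by (simp only: elimination_eval)

lemma computed_rank_3: "computed_rank (Suc (Suc (Suc 0))) = Some 209"
  by (simp only: elimination_eval)

lemma computed_rank_4: "computed_rank (Suc (Suc (Suc (Suc 0)))) = Some 564"
  by (simp only: elimination_eval)

lemma computed_rank_5: "computed_rank (Suc (Suc (Suc (Suc (Suc 0))))) = Some 1019"
  by (simp only: elimination_eval)

lemma computed_rank_6: "computed_rank (Suc (Suc (Suc (Suc (Suc (Suc 0)))))) = Some 1379"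
  by (simp only: elimination_eval)

lemma computed_rank_7: "computed_rank (Suc (Suc (Suc (Suc (Suc (Suc (Suc 0))))))) = Some 1379"
  by (simp only: elimination_eval)

lemma computed_rank_8: "computed_rank (Suc (Suc (Suc (Suc (Suc (Suc (Suc (Suc 0)))))))) = Some 1019"
  by (simp only: elimination_eval)

lemma computed_rank_9: "computed_rank (Suc (Suc (Suc (Suc (Suc (Suc (Suc (Suc (Suc 0))))))))) = Some 564"
  by (simp only: elimination_eval)

lemma computed_rank_10: "computed_rank (Suc (Suc (Suc (Suc (Suc (Suc (Suc (Suc (Suc (Suc 0)))))))))) = Some 209"
  by (simp only: elimination_eval)

lemma computed_rank_11: "computed_rank (Suc (Suc (Suc (Suc (Suc (Suc (Suc (Suc (Suc (Suc (Suc 0))))))))))) = Some 54"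
  by (simp only: elimination_eval)

lemma computed_rank_12: "computed_rank (Suc (Suc (Suc (Suc (Suc (Suc (Suc (Suc (Suc (Suc (Suc (Suc 0)))))))))))) = Some 6"
  by (simp only: elimination_eval)

lemma computed_rank_13: "computed_rank (Suc (Suc (Suc (Suc (Suc (Suc (Suc (Suc (Suc (Suc (Suc (Suc (Suc 0))))))))))))) = Some 0"
  by (simp only: elimination_eval)

lemma computed_rank_14: "computed_rank (Suc (Suc (Suc (Suc (Suc (Suc (Suc (Suc (Suc (Suc (Suc (Suc (Suc (Suc 0)))))))))))))) = Some 0"
  by (simp only: elimination_eval)

text \<open>The default value covers degrees 13 and above. The symmetry under
  \<open>n -> 13 - n\<close> reflects Poincare duality on 14 generators.\<close>

definition rank14 :: "nat \<Rightarrow> nat" where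
  "rank14 = nth_default 0 [0, 6, 54, 209, 564, 1019, 1379, 1379, 1019, 564, 209, 54, 6]"

lemma computed_rank:
  assumes "n \<le> 14"
  shows "computed_rank n = Some (rank14 n)"
proof -
  have "n = 0 \<or> n = 1 \<or> n = 2 \<or> n = 3 \<or> n = 4 \<or> n = 5 \<or> n = 6 \<or> n = 7 \<or> n = 8 \<or> n = 9 \<or> n = 10 \<or> n = 11 \<or> n = 12 \<or> n = 13 \<or> n = 14"
    using assms by presburger
  then show ?thesis
    using computed_rank_0 computed_rank_1 computed_rank_2 computed_rank_3 computed_rank_4 computed_rank_5
      computed_rank_6 computed_rank_7 computed_rank_8 computed_rank_9 computed_rank_10 computed_rank_11
      computed_rank_12 computed_rank_13 computed_rank_14
    by (elim disjE) (simp_all add: rank14_def nth_default_def eval_nat_numeral)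
qed

section \<open>The Poincare series\<close>

lemma forms_trivial:
  assumes "finite G" "card G < n"
  shows "forms G n = {0}"
proof -
  have "x = 0" if "x \<in> forms G n" for x :: "'a ext"
  proof
    fix S
    show "x S = 0 S" using formsD[OF that, of S] card_mono[OF assms(1), of S] assms(2) by fastforce
  qed
  then show ?thesis using forms_zero by blast
qed

lemma card_diff_on_forms:
  assumes "(2 :: 'a::{field,finite}) \<noteq> 0" "(3 :: 'a) \<noteq> 0"
  shows "card (diff_on (set ups) ` (forms ({..<8} \<union> set ups) n :: 'a ext set)) = card (UNIV :: 'a set) ^ rank14 n"
proof (cases "n \<le> 14")
  case True
  have "ext.dim (diff_on (set ups) ` (forms ({..<8} \<union> set ups) n :: 'a ext set)) = rank14 n"
    using computed_rank[OF True] unfolding computed_rank_def by (rule dim_diff_on_forms[OF assms])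
  moreover
  have "finite (diff_on (set ups) ` (forms ({..<8} \<union> set ups) n :: 'a ext set))"
    by (intro finite_imageI finite_forms) simp
  then have "card (diff_on (set ups) ` (forms ({..<8} \<union> set ups) n :: 'a ext set)) =
      card (UNIV :: 'a set) ^ ext.dim (diff_on (set ups) ` (forms ({..<8} \<union> set ups) n :: 'a ext set))"
    by (rule ext.card_subspace[OF subspace_diff_on_image])
  ultimately show ?thesis by simp
next
  case False
  have fin: "finite ({..<8} \<union> set ups)" by simp
  have "card ({..<8} \<union> set ups) = card {..<8::nat} + card (set ups)" by (rule card_Un_disjoint) auto
  then have "card ({..<8} \<union> set ups) = 14" by simp
  then have "(forms ({..<8} \<union> set ups) n :: 'a ext set) = {0}"
    using False by (intro forms_trivial fin) simp
  moreover have "rank14 n = 0" using False by (simp add: rank14_def nth_default_def)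
  ultimately show ?thesis by (simp add: diff_on_zero)
qed

text \<open>Coefficients of the series of \<open>r\<close> times \<open>1 + t\<close>: the effect on
  the ranks of adjoining a free exterior generator.\<close>

definition add_shifted :: "(nat \<Rightarrow> nat) \<Rightarrow> nat \<Rightarrow> nat" where
  "add_shifted r n = r n + (if n = 0 then 0 else r (n - 1))"

lemma card_diff_on_insert_add_shifted:
  assumes "finite G" "c \<notin> G" "8 \<le> c" "c \<notin> K"
    and "\<And>n. card (diff_on K ` (forms G n :: 'a::{field,finite} ext set)) = card (UNIV :: 'a set) ^ r n"
  shows "card (diff_on K ` (forms (insert c G) n :: 'a ext set)) = card (UNIV :: 'a set) ^ add_shifted r n"
proof (cases n)
  case 0
  then show ?thesis using card_diff_on_image_insert(2)[OF assms(1-4), where ?'a = 'a] assms(5)[of 0] by (simp add: add_shifted_def)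
next
  case (Suc m)
  then show ?thesis using card_diff_on_image_insert(1)[OF assms(1-4), of m, where ?'a = 'a] assms(5)
    by (simp add: add_shifted_def power_add)
qed

lemma card_ediff_forms:
  assumes "(2 :: 'a::{field,finite}) \<noteq> 0" "(3 :: 'a) \<noteq> 0"
  shows "card (ediff ` (forms gens n :: 'a ext set)) = card (UNIV :: 'a set) ^ add_shifted (add_shifted rank14) n"
proof -
  have gens: "gens = insert 11 (insert 10 ({..<8} \<union> set ups))" by (auto simp: gens_def)
  have 1: "card (diff_on (set ups) ` (forms (insert 10 ({..<8} \<union> set ups)) n :: 'a ext set)) = card (UNIV :: 'a set) ^ add_shifted rank14 n" for n
    by (rule card_diff_on_insert_add_shifted[OF _ _ _ _ card_diff_on_forms[OF assms]]) auto
  have "card (diff_on (set ups) ` (forms gens n :: 'a ext set)) = card (UNIV :: 'a set) ^ add_shifted (add_shifted rank14) n"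
    unfolding gens by (rule card_diff_on_insert_add_shifted[OF _ _ _ _ 1]) auto
  then show ?thesis using card_ediff_image[of n, where ?'a = 'a] by simp
qed

text \<open>Counting forms as kernel times image gives dimension \<open>(16 choose n)\<close> minus
  the rank for the cocycles; the coboundaries are the image from one degree below.\<close>

lemma cohom_rank_eq:
  fixes F :: "'a::{field,finite} itself"
  assumes "(2 :: 'a) \<noteq> 0" "(3 :: 'a) \<noteq> 0"
  shows "cohom_rank F n = (16 choose n) - add_shifted (add_shifted rank14) n - (if n = 0 then 0 else add_shifted (add_shifted rank14) (n - 1))"
proof -
  let ?q = "card (UNIV :: 'a set)" and ?r = "add_shifted (add_shifted rank14)"
  \<comment> \<open>Exponents can be compared only for a base above 1.\<close>
  have q: "1 < ?q"
    using card_mono[of UNIV "{0, 1 :: 'a}"] by simp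
  have fin: "finite gens" "card gens = 16" by (simp_all add: gens_def)
  have image: "ediff ` (forms gens m :: 'a ext set) = diff_on {8..<16} ` forms gens m" for m
    using ediff_eq_diff_on by (intro image_cong) auto
  have "ext.dim (coboundaries n :: 'a ext set) = (if n = 0 then 0 else ?r (n - 1))"
  proof (cases n)
    case 0
    \<comment> \<open>In degree 0 no \<open>m\<close> satisfies \<open>Suc m = n\<close>, so this
      set is empty rather than \<open>{0}\<close>; its dimension is still 0.\<close>
    then have "(coboundaries n :: 'a ext set) = {}" by (auto simp: coboundaries_def)
    then show ?thesis using 0 ext.dim_eq_card_independent[OF ext.independent_empty] by simp
  next
    case (Suc m)
    then have cob: "(coboundaries n :: 'a ext set) = ediff ` forms gens m"
      by (auto simp: coboundaries_def cochains_eq_forms)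
    have "card (coboundaries n :: 'a ext set) = ?q ^ ext.dim (coboundaries n :: 'a ext set)"
      unfolding cob image by (intro ext.card_subspace subspace_diff_on_image finite_imageI finite_forms fin)
    then show ?thesis
      using card_ediff_forms[OF assms, of m] q Suc unfolding cob by (simp add: power_inject_exp)
  qed
  moreover have "ext.dim (cocycles n :: 'a ext set) + ?r n = (16 choose n)"
  proof -
    have cyc: "(cocycles n :: 'a ext set) = {x \<in> forms gens n. diff_on {8..<16} x = 0}"
      unfolding cocycles_def cochains_eq_forms ext_ops using ediff_eq_diff_on[where ?'a = 'a and n = n]
      by (intro Collect_cong) auto
    have "ext.subspace (cocycles n :: 'a ext set)"
      unfolding cyc by (rule ext.subspaceI)
        (auto simp: forms_zero forms_add forms_scale diff_on_zero diff_on_add diff_on_scale escale_simps)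
    moreover have "finite (cocycles n :: 'a ext set)" 
      unfolding cyc using finite_forms[OF fin(1), of n, where ?'a = 'a] by (rule rev_finite_subset) auto
    ultimately have "card (cocycles n :: 'a ext set) = ?q ^ ext.dim (cocycles n :: 'a ext set)"
      by (rule ext.card_subspace)
    moreover have "card (forms gens n :: 'a ext set) = card (cocycles n :: 'a ext set) * card (diff_on {8..<16} ` (forms gens n :: 'a ext set))"
      unfolding cyc by (rule card_additive_image) (auto simp: finite_forms fin forms_diff forms_add diff_on_add)
    ultimately have "?q ^ (16 choose n) = ?q ^ (ext.dim (cocycles n :: 'a ext set) + ?r n)"
      using card_forms[OF fin(1), of n, where ?'a = 'a] card_ediff_forms[OF assms, of n] fin(2)
      by (simp add: image power_add)
    then show ?thesis using q by (simp add: power_inject_exp)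
  qed
  ultimately show ?thesis unfolding cohom_rank_def by simp
qed

lemma poincare_poly_eq:
  "poincare_poly = Poly [1, 10, 48, 171, 461, 976, 1671, 2303, 2558, 2303, 1671, 976, 461, 171, 48, 10, 1]"
proof -
  have "[:1, 1:] ^ 4 = [:1, 4, 6, 4, 1 :: int:]" by (simp add: power4_eq_xxxx)
  then show ?thesis by (simp add: poincare_poly_def)
qed

lemma binomial_and_rank_values:
  assumes "n < 17"
  shows "16 choose n = [1, 16, 120, 560, 1820, 4368, 8008, 11440, 12870, 11440, 8008, 4368, 1820, 560, 120, 16, 1] ! n"
    and "add_shifted (add_shifted rank14) n =
      [0, 6, 66, 323, 1036, 2356, 3981, 5156, 5156, 3981, 2356, 1036, 323, 66, 6, 0, 0] ! n"
proof -
  have cases: "n = 0 \<or> n = 1 \<or> n = 2 \<or> n = 3 \<or> n = 4 \<or> n = 5 \<or> n = 6 \<or> n = 7 \<or> n = 8 \<or> n = 9 \<or> n = 10 \<or> n = 11 \<or> n = 12 \<or> n = 13 \<or> n = 14 \<or> n = 15 \<or> n = 16"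
    using assms by presburger
  then show "16 choose n = [1, 16, 120, 560, 1820, 4368, 8008, 11440, 12870, 11440, 8008, 4368, 1820, 560, 120, 16, 1] ! n"
    by (elim disjE) (simp_all add: binomial_fact' fact_numeral)
  from cases show "add_shifted (add_shifted rank14) n =
      [0, 6, 66, 323, 1036, 2356, 3981, 5156, 5156, 3981, 2356, 1036, 323, 66, 6, 0, 0] ! n"
    by (elim disjE) (simp_all add: add_shifted_def rank14_def nth_default_def)
qed

theorem theorem5p8:
  fixes p :: nat and F :: "'a::{field, finite} itself"
  assumes "prime p" and "p > 3" and "card (UNIV :: 'a set) = p"
  shows "(\<forall>n. int (cohom_rank F n) = coeff poincare_poly n)
     \<and> map (cohom_rank F) [0..<10] = [1, 10, 48, 171, 461, 976, 1671, 2303, 2558, 2303]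
     \<and> cohom_rank F 16 = 1"
proof -
  have nz: "(2 :: 'a) \<noteq> 0" "(3 :: 'a) \<noteq> 0"
    using of_nat_nonzero[of 2, where ?'a = 'a] of_nat_nonzero[of 3, where ?'a = 'a] assms by simp_all
  let ?L = "[1, 10, 48, 171, 461, 976, 1671, 2303, 2558, 2303, 1671, 976, 461, 171, 48, 10, 1] :: nat list"
  have rank: "cohom_rank F n = nth_default 0 ?L n" for n
  proof (cases "n < 17")
    case True
    then have "n = 0 \<or> n = 1 \<or> n = 2 \<or> n = 3 \<or> n = 4 \<or> n = 5 \<or> n = 6 \<or> n = 7 \<or> n = 8 \<or> n = 9 \<or> n = 10 \<or> n = 11 \<or> n = 12 \<or> n = 13 \<or> n = 14 \<or> n = 15 \<or> n = 16"
      by presburger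
    then show ?thesis
      by (elim disjE) (simp_all add: cohom_rank_eq[OF nz] binomial_and_rank_values nth_default_def)
  next
    case False
    \<comment> \<open>Above degree 16 the truncated subtraction starts from 0, matching the default
      of \<open>nth_default\<close>.\<close>
    then have *: "16 choose n = 0" by (intro binomial_eq_0) simp
    show ?thesis unfolding cohom_rank_eq[OF nz] * using False by (simp add: nth_default_def)
  qed
  have L: "nth_default 0 (map int ?L) n = int (nth_default 0 ?L n)" for n
    by (rule nth_default_map_eq) simp
  have poly: "poincare_poly = Poly (map int ?L)" by (simp add: poincare_poly_eq)
  have "int (cohom_rank F n) = coeff poincare_poly n" for n
    unfolding rank poly coeff_Poly_eq L ..
  then show ?thesis by (simp add: rank nth_default_def upt_rec)
qed

end
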